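(* The positive-index map $\pi^+:\mathrm{span}_{\mathbb{Q}}\{\mathcal{I}^{\mathrm{adm}}\}\to\mathrm{span}_{\mathbb{Q}}\{\mathcal{I}^{\mathrm{adm}}_{>0}\}$ is a homomorphism of $\mathbb{Q}$-algebras for the shuffle product, i.e. $\pi^+(\Sigma\sqcup\!\sqcup\Sigma')=\pi^+(\Sigma)\sqcup\!\sqcup\pi^+(\Sigma')$ for all $\Sigma,\Sigma'\in\mathrm{span}_{\mathbb{Q}}\{\mathcal{I}^{\mathrm{adm}}\}$.
   Context: An integer index is a tuple $\mathbf{k}=(k_1,\dots,k_r)\in\mathbb{Z}^r$, $r\ge0$ ($\emptyset$ for $r=0$); $\mathcal{I}=\bigsqcup_{r\ge0}\mathbb{Z}^r$, $\mathcal{I}_{>0}=\bigsqcup_{r\ge0}\mathbb{Z}_{>0}^r$, and $\mathrm{span}_{\mathbb{Q}}\{S\}$ denotes the formal $\mathbb{Q}$-vector space with basis $S$. For $r\ge1$, $m_{\mathbf{k}}=\min_{1\le t\le r}\sum_{i=t}^r(k_i-1)$, and $m_\emptyset=\infty$. $\mathbf{k}$ is admissible if $m_{\mathbf{k}}>0$ and regularizable if $m_{\mathbf{k}}\ge0$; $\mathcal{I}^{\mathrm{adm}}$ is the set of admissible indices and $\mathcal{I}^{\mathrm{adm}}_{>0}=\mathcal{I}^{\mathrm{adm}}\cap\mathcal{I}_{>0}$. Positive-index map: Let $B_n^{\pm}$ be the Bernoulli numbers with $\frac{t}{1-e^{-t}}=\sum_n B_n^+\frac{t^n}{n!}$, $\frac{t}{e^t-1}=\sum_n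 B_n^-\frac{t^n}{n!}$. For a regularizable $\mathbf{k}=(k_1,\dots,k_r)$: if $\mathbf{k}\in\mathcal{I}_{>0}$ set $\pi^+(\mathbf{k})=\mathbf{k}$. Otherwise let $m$ be the smallest index with $k_m\le0$ (then $m<r$), and for $0\le i\le -k_m$ put $\mathbf{k}^+_{m,i}=(k_1,\dots,k_{m-1},k_{m+1}+k_m-1+i,k_{m+2},\dots,k_r)$, $\mathbf{k}_{\hat m}=(k_1,\dots,k_{m-1},k_{m+1},\dots,k_r)$, and if $m\ge2$, $\mathbf{k}^-_{m,i}=(k_1,\dots,k_{m-2},k_{m-1}+k_m-1+i,k_{m+1},\dots,k_r)$. Let $R(\mathbf{k})=\frac{1}{1-k_m}\sum_{i=0}^{-k_m}\binom{1-k_m}{i}B_i^-\mathbf{k}^+_{m,i}-\delta_{k_m,0}\mathbf{k}_{\hat m}-\epsilon_m\frac{1}{1-k_m}\sum_{i=0}^{-k_m}\binom{1-k_m}{i}B_i^+\mathbf{k}^-_{m,i}$, where $\epsilon_m=1$ if $m\ge2$ and $\epsilon_m=0$ if $m=1$. All indices in $R(\mathbf{k})$ have depth $r-1$ and are regularizable (admissible if $\mathbf{k}$ is), and one sets $\pi^+(\mathbf{k})=\pi^+(R(\mathbf{k}))$ (recursion on depth), extended $\mathbb{Q}$-linearly. This gives a $\mathbb{Q}$-linear map $\pi^+:\mathrm{span}_{\mathbb{Q}}\{\mathcal{I}^{\mathrm{adm}}\}\to\mathrm{span}_{\mathbb{Q}}\{\mathcal{I}^{\mathrm{adm}}_{>0}\}$.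 (It satisfies $\mathrm{Li}_{\mathbf{k}}(z)=\sum c_{\mathbf{l}}\mathrm{Li}_{\mathbf{l}}(z)$ if $\pi^+(\mathbf{k})=\sum c_{\mathbf{l}}\mathbf{l}$, where $\mathrm{Li}_{\mathbf{k}}(z)=\sum_{0<n_1<\cdots<n_r}z^{n_r}/(n_1^{k_1}\cdots n_r^{k_r})$.) Shuffle product of integer indices: Let $W$ be the set of words in the letters $j,d,y$ subject to $jd=dj=\mathbf{1}$ ($\mathbf{1}$ the empty word); each $w\in W$ is uniquely $j^{a_1}yj^{a_2}y\cdots yj^{a_s}$ with $s\ge1$, $a_i\in\mathbb{Z}$, where $j^{-1}=d$ and $j^0=\mathbf{1}$; its length is $|a_1|+\cdots+|a_s|+(s-1)$. Let $A$ be the $\mathbb{Q}$-vector space with basis $W$. The bilinear product $\sqcup\!\sqcup$ on $A$ is defined by $\mathbf{1}\sqcup\!\sqcup w=w\sqcup\!\sqcup\mathbf{1}=w$ and, recursively on the sum of the lengths, for words $u,v$: (i) $yu\sqcup\!\sqcup v=u\sqcup\!\sqcup yv=y(u\sqcup\!\sqcup v)$; (ii) $ju\sqcup\!\sqcup jv=j(u\sqcup\!\sqcup jv)+j(ju\sqcup\!\sqcup v)$; (iii) $du\sqcup\!\sqcup dv=d(u\sqcup\!\sqcup dv)-u\sqcup\!\sqcup d^2v$; (iv) $du\sqcup\!\sqcup jv=d(u\sqcup\!\sqcup jv)-u\sqcup\!\sqcup v$; (v) $ju\sqcup\!\sqcup dv=d(ju\sqcup\!\sqcup v)-u\sqcup\!\sqcup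 v$. Let $\mathcal{T}$ be the span of the words $j^{a_1}y\cdots yj^{a_s}$ with $a_s\neq0$ (a two-sided ideal of $(A,\sqcup\!\sqcup)$). Let $\mathcal{L}$ be the smallest two-sided ideal of $A/\mathcal{T}$ stable under left concatenation with $j$ or $d$ and containing all $d(u\sqcup\!\sqcup v)-du\sqcup\!\sqcup v-u\sqcup\!\sqcup dv$ for words $u,v$ ending in $y$. Let $B=A/(\mathcal{T}+\mathcal{L})$; $(B,\sqcup\!\sqcup)$ is a commutative associative unital algebra. For $\mathbf{k}=(k_1,\dots,k_r)$ put $w_{\mathbf{k}}=j^{k_r}yj^{k_{r-1}}y\cdots j^{k_1}y$ and $w_\emptyset=\mathbf{1}$; the classes of $w_{\mathbf{k}}$, $\mathbf{k}\in\mathcal{I}$, form a basis of $B$, giving a linear bijection $\phi:\mathrm{span}_{\mathbb{Q}}\{\mathcal{I}\}\to B$, $\mathbf{k}\mapsto[w_{\mathbf{k}}]$. The shuffle product on $\mathrm{span}_{\mathbb{Q}}\{\mathcal{I}\}$ is $\mathbf{k}\sqcup\!\sqcup\mathbf{k}'=\phi^{-1}(\phi(\mathbf{k})\sqcup\!\sqcup\phi(\mathbf{k}'))$; $\mathrm{span}_{\mathbb{Q}}\{\mathcal{I}^{\mathrm{adm}}\}$ and $\mathrm{span}_{\mathbb{Q}}\{\mathcal{I}^{\mathrm{adm}}_{>0}\}$ are closed under it.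
   Formalization: Since φ is not injective ([w_(0,-1)] = 2[w_(-1,0)]) and T is not an ideal of A, the shuffle product is computed in the span of the words w_k in place of A/T; π⁺ is also shown to have the same value on every admissible preimage under φ of the product in B. *)

theory Defs
  imports
    Complex_Main
    "HOL-Library.Poly_Mapping"
    "HOL-Library.Extended_Real"
    "HOL-Computational_Algebra.Formal_Power_Series"
begin

section \<open>Formal rational vector spaces\<close>

type_synonym 'a formal = "'a \<Rightarrow>\<^sub>0 rat"

abbreviation basis :: "'a \<Rightarrow> 'a formal" where
  "basis a \<equiv> Poly_Mapping.single a 1"

definition formal_span :: "'a set \<Rightarrow> 'a formal set" where
  "formal_span S = {x. Poly_Mapping.keys x \<subseteq> S}"

definition scale :: "rat \<Rightarrow> 'a formal \<Rightarrow> 'a formal" where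
  "scale c x = Poly_Mapping.map ((*) c) x"

definition lin_ext :: "('a \<Rightarrow> 'b formal) \<Rightarrow> 'a formal \<Rightarrow> 'b formal" where
  "lin_ext f x = (\<Sum>a\<in>Poly_Mapping.keys x. scale (Poly_Mapping.lookup x a) (f a))"

lemma lin_ext_cong [fundef_cong]:
  assumes "x = y" and "\<And>a. a \<in> Poly_Mapping.keys y \<Longrightarrow> f a = g a"
  shows "lin_ext f x = lin_ext g y"
  using assms unfolding lin_ext_def by (auto intro: sum.cong)

section \<open>Indices\<close>

text \<open>An index \<open>(k\<^sub>1, \<dots>, k\<^sub>r)\<close> is a list, with \<open>k\<^sub>i\<close> in position \<open>i - 1\<close>.\<close>

type_synonym index = "int list"

definition min_tail :: "index \<Rightarrow> ereal" where
  "min_tail k = (if k = [] then \<infinity> else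
     ereal (of_int (Min ((\<lambda>t. \<Sum>i\<in>{t..<length k}. k ! i - 1) ` {..<length k}))))"

definition positive :: "index \<Rightarrow> bool" where
  "positive k \<longleftrightarrow> (\<forall>a\<in>set k. 0 < a)"

definition admissible :: "index \<Rightarrow> bool" where
  "admissible k \<longleftrightarrow> 0 < min_tail k"

definition regularizable :: "index \<Rightarrow> bool" where
  "regularizable k \<longleftrightarrow> 0 \<le> min_tail k"

definition adm :: "index set" where
  "adm = {k. admissible k}"

definition adm_pos :: "index set" where
  "adm_pos = {k. admissible k \<and> positive k}"

section \<open>The positive-index map\<close>

text \<open>In both quotients numerator and denominator have subdegree 1, so division of
  power series is exact here.\<close>

definition bernoulli_minus :: "nat \<Rightarrow> rat" where
  "bernoulli_minus n = fact n * fps_nth (fps_X / (fps_exp 1 - 1)) n"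

definition bernoulli_plus :: "nat \<Rightarrow> rat" where
  "bernoulli_plus n = fact n * fps_nth (fps_X / (1 - fps_exp (- 1))) n"

lemma bernoulli_minus_gf: "(fps_X / (fps_exp 1 - 1)) * (fps_exp 1 - 1) = (fps_X :: rat fps)"
proof (rule dvd_div_mult_self)
  have "subdegree (fps_exp 1 - 1 :: rat fps) = 1"
    by (rule subdegreeI) auto
  then show "fps_exp 1 - 1 dvd (fps_X :: rat fps)"
    by (subst fps_dvd_iff) auto
qed

lemma bernoulli_plus_gf: "(fps_X / (1 - fps_exp (-1))) * (1 - fps_exp (-1)) = (fps_X :: rat fps)"
proof (rule dvd_div_mult_self)
  have "subdegree (1 - fps_exp (-1) :: rat fps) = 1"
    by (rule subdegreeI) auto
  then show "1 - fps_exp (-1) dvd (fps_X :: rat fps)"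
    by (subst fps_dvd_iff) auto
qed

definition first_nonpos :: "index \<Rightarrow> nat" where
  "first_nonpos k = (LEAST m. m < length k \<and> k ! m \<le> 0)"

definition merge_right :: "index \<Rightarrow> nat \<Rightarrow> nat \<Rightarrow> index" where
  "merge_right k m i = take m k @ [k ! (m + 1) + k ! m - 1 + int i] @ drop (m + 2) k"

definition merge_left :: "index \<Rightarrow> nat \<Rightarrow> nat \<Rightarrow> index" where
  "merge_left k m i = take (m - 1) k @ [k ! (m - 1) + k ! m - 1 + int i] @ drop (m + 1) k"

definition delete_at :: "index \<Rightarrow> nat \<Rightarrow> index" where
  "delete_at k m = take m k @ drop (m + 1) k"

text \<open>The list position \<open>m\<close> below is the mathematical position minus 1, so the left-hand
  neighbour exists iff \<open>0 < m\<close>.\<close>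

definition reduce :: "index \<Rightarrow> index formal" where
  "reduce k = (let m = first_nonpos k; a = k ! m in
     scale (1 / of_int (1 - a)) (\<Sum>i\<in>{0..nat (- a)}.
        scale (of_nat (nat (1 - a) choose i) * bernoulli_minus i) (basis (merge_right k m i)))
   - (if a = 0 then basis (delete_at k m) else 0)
   - (if 0 < m then
        scale (1 / of_int (1 - a)) (\<Sum>i\<in>{0..nat (- a)}.
          scale (of_nat (nat (1 - a) choose i) * bernoulli_plus i) (basis (merge_left k m i)))
      else 0))"

lemma keys_scale: "Poly_Mapping.keys (scale c x) \<subseteq> Poly_Mapping.keys x"
  unfolding scale_def by transfer auto

lemma keys_sum_subset: "Poly_Mapping.keys (sum f S) \<subseteq> (\<Union>a\<in>S. Poly_Mapping.keys (f a))"
proof (induction S rule: infinite_finite_induct)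
  case (insert a S)
  then show ?case using keys_add[of "f a" "sum f S"] by auto
qed auto

lemma keys_diff_subset: "Poly_Mapping.keys (x - y) \<subseteq> Poly_Mapping.keys x \<union> Poly_Mapping.keys (y :: 'a formal)"
  by transfer auto

lemma regularizable_iff:
  "regularizable k \<longleftrightarrow> (\<forall>t<length k. 0 \<le> (\<Sum>i\<in>{t..<length k}. k ! i - 1))"
proof (cases "k = []")
  case False
  then have "{..<length k} \<noteq> {}" by (simp add: lessThan_empty_iff)
  with False show ?thesis unfolding regularizable_def min_tail_def by (auto simp: Min_ge_iff)
qed (simp add: regularizable_def min_tail_def)

lemma first_nonpos_lt:
  assumes "regularizable k" and "\<not> positive k"
  shows "first_nonpos k + 1 < length k"
proof -
  have "\<exists>m. m < length k \<and> k ! m \<le> 0"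
    using assms(2) by (auto simp: positive_def in_set_conv_nth not_less)
  from LeastI_ex[OF this]
  have m: "first_nonpos k < length k" "k ! first_nonpos k \<le> 0"
    unfolding first_nonpos_def by auto
  then have "{length k - 1..<length k} = {length k - 1}" by auto
  then have "0 \<le> k ! (length k - 1) - 1"
    using assms(1) m(1) by (auto simp: regularizable_iff dest: spec[of _ "length k - 1"])
  with m have "first_nonpos k \<noteq> length k - 1" by auto
  with m(1) show ?thesis by linarith
qed

lemma length_reduce:
  assumes "regularizable k" and "\<not> positive k" and "l \<in> Poly_Mapping.keys (reduce k)"
  shows "length l < length k"
proof -
  let ?m = "first_nonpos k"
  have m: "?m + 1 < length k" using first_nonpos_lt[OF assms(1,2)] .
  have "Poly_Mapping.keys (reduce k) \<subseteq> range (merge_right k ?m) \<union> {delete_at k ?m}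
      \<union> (if 0 < ?m then range (merge_left k ?m) else {})"
    unfolding reduce_def Let_def
    by (intro order_trans[OF keys_diff_subset] Un_least)
       (auto dest!: subsetD[OF keys_diff_subset] subsetD[OF keys_scale]
          subsetD[OF keys_sum_subset] split: if_splits)
  with assms(3) m show ?thesis
    by (auto simp: merge_right_def merge_left_def delete_at_def split: if_splits)
qed

text \<open>The map is only meant for regularizable indices; elsewhere it has the dummy value 0.\<close>

function pi_index :: "index \<Rightarrow> index formal" where
  "pi_index k = (if positive k then basis k
     else if regularizable k then lin_ext pi_index (reduce k) else 0)"
  by pat_completeness auto
termination
  by (relation "measure length") (auto simp: length_reduce)

declare pi_index.simps [simp del]

definition pi_plus :: "index formal \<Rightarrow> index formal" where
  "pi_plus = lin_ext pi_index"

section \<open>The shuffle product on words\<close>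

datatype letter = J | D | Y

text \<open>Words modulo \<open>jd = dj = 1\<close> are represented by their normal forms, in which \<open>j\<close>
  and \<open>d\<close> are never adjacent; these are the lists
  \<open>j\<^bsup>a\<^sub>1\<^esup> y j\<^bsup>a\<^sub>2\<^esup> y \<dots> y j\<^bsup>a\<^sub>s\<^esup>\<close> with \<open>j\<^bsup>-n\<^esup> = d\<^bsup>n\<^esup>\<close>.\<close>

definition words :: "letter list set" where
  "words = {w. \<forall>i. Suc i < length w \<longrightarrow> (w ! i, w ! Suc i) \<notin> {(J, D), (D, J)}}"

fun lcons :: "letter \<Rightarrow> letter list \<Rightarrow> letter list" where
  "lcons J (D # w) = w"
| "lcons D (J # w) = w"
| "lcons c w = c # w"

definition lconc :: "letter \<Rightarrow> letter list formal \<Rightarrow> letter list formal" where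
  "lconc c = lin_ext (\<lambda>w. basis (lcons c w))"

text \<open>The pattern variables match normal forms. The rules are not valid for unreduced words;
  for instance, applied to \<open>dy\<close> and \<open>j d = \<one>\<close>, the one for first letters \<open>d\<close> and \<open>j\<close>
  would give \<open>dy = dy - yd\<close>. The rule for two words beginning with \<open>d\<close> keeps the total length and shortens
  the first word.\<close>

function (sequential) shuffle_words :: "letter list \<Rightarrow> letter list \<Rightarrow> letter list formal" where
  "shuffle_words [] v = basis v"
| "shuffle_words u [] = basis u"
| "shuffle_words (Y # u) v = lconc Y (shuffle_words u v)"
| "shuffle_words u (Y # v) = lconc Y (shuffle_words u v)"
| "shuffle_words (J # u) (J # v) =
     lconc J (shuffle_words u (J # v)) + lconc J (shuffle_words (J # u) v)"
| "shuffle_words (D # u) (D # v) =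
     lconc D (shuffle_words u (D # v)) - shuffle_words u (D # D # v)"
| "shuffle_words (D # u) (J # v) =
     lconc D (shuffle_words u (J # v)) - shuffle_words u v"
| "shuffle_words (J # u) (D # v) =
     lconc D (shuffle_words (J # u) v) - shuffle_words u v"
  by pat_completeness auto
termination
  by (relation "measures [\<lambda>(u, v). length u + length v, \<lambda>(u, v). length u]") auto

definition shuffle :: "letter list formal \<Rightarrow> letter list formal \<Rightarrow> letter list formal" where
  "shuffle x y = lin_ext (\<lambda>u. lin_ext (\<lambda>v. shuffle_words u v) y) x"

section \<open>The shuffle algebra of indices\<close>

text \<open>The normal forms with \<open>a\<^sub>s = 0\<close>: the empty word and the words ending in \<open>y\<close>.\<close>

definition y_words :: "letter list set" where
  "y_words = {w \<in> words. w = [] \<or> last w = Y}"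

definition T_span :: "letter list formal set" where
  "T_span = formal_span (words - y_words)"

text \<open>The words in \<open>y_words\<close> form a basis of \<open>A/T_span\<close>; \<open>mod_T\<close> sends an element of
  \<open>A\<close> to the representative of its class in their span, and \<open>A/T_span\<close> is identified with that
  span. The product and the concatenation operators of \<open>A/T_span\<close> are computed on these
  representatives. The choice of representatives matters: on all of \<open>A\<close>, \<open>T_span\<close> is neither an
  ideal (\<open>j \<squnion> jy = jjy + jyj\<close>) nor stable under concatenation (\<open>j d = \<one>\<close>). The span of
  \<open>y_words\<close> is closed under the shuffle product.\<close>

definition mod_T :: "letter list formal \<Rightarrow> letter list formal" where
  "mod_T = lin_ext (\<lambda>w. if w \<in> y_words then basis w else 0)"

inductive_set L_ideal :: "letter list formal set" where
  zero: "0 \<in> L_ideal"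
| add: "x \<in> L_ideal \<Longrightarrow> x' \<in> L_ideal \<Longrightarrow> x + x' \<in> L_ideal"
| scale: "x \<in> L_ideal \<Longrightarrow> scale c x \<in> L_ideal"
| left: "x \<in> L_ideal \<Longrightarrow> u \<in> formal_span y_words \<Longrightarrow> mod_T (shuffle u x) \<in> L_ideal"
| right: "x \<in> L_ideal \<Longrightarrow> u \<in> formal_span y_words \<Longrightarrow> mod_T (shuffle x u) \<in> L_ideal"
| conc: "x \<in> L_ideal \<Longrightarrow> c \<in> {J, D} \<Longrightarrow> mod_T (lconc c x) \<in> L_ideal"
| leibniz: "u \<in> words \<Longrightarrow> v \<in> words \<Longrightarrow> u \<noteq> [] \<Longrightarrow> last u = Y \<Longrightarrow> v \<noteq> [] \<Longrightarrow> last v = Y \<Longrightarrow>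
    mod_T (lconc D (shuffle_words u v)
      - shuffle_words (lcons D u) v - shuffle_words u (lcons D v)) \<in> L_ideal"

definition B_class :: "letter list formal \<Rightarrow> letter list formal set" where
  "B_class x = {x + t + l | t l. t \<in> T_span \<and> l \<in> L_ideal}"

text \<open>All classes in the union coincide if \<open>b\<close> and \<open>b'\<close> are elements of \<open>B\<close>.\<close>

definition B_mult :: "letter list formal set \<Rightarrow> letter list formal set \<Rightarrow> letter list formal set" where
  "B_mult b b' = (\<Union>u \<in> b \<inter> formal_span y_words. \<Union>v \<in> b' \<inter> formal_span y_words.
     B_class (shuffle u v))"

definition jpow :: "int \<Rightarrow> letter list" where
  "jpow a = (if 0 \<le> a then replicate (nat a) J else replicate (nat (- a)) D)"

definition index_word :: "index \<Rightarrow> letter list" where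
  "index_word k = concat (map (\<lambda>a. jpow a @ [Y]) (rev k))"

definition word_map :: "index formal \<Rightarrow> letter list formal" where
  "word_map = lin_ext (\<lambda>k. basis (index_word k))"

definition phi :: "index formal \<Rightarrow> letter list formal set" where
  "phi x = B_class (word_map x)"

text \<open>The map \<open>phi\<close> onto \<open>B\<close> is not injective (see \<open>phi_not_inj\<close>), so the preimage of
  a product under \<open>phi\<close> has to be chosen. \<open>word_map\<close> is a linear bijection onto the span of
  \<open>y_words\<close>, i.e. onto \<open>A/T_span\<close>, and the preimage is taken there; by \<open>phi_index_shuffle\<close> it
  is a preimage under \<open>phi\<close> of the product in \<open>B\<close>.\<close>

definition index_shuffle :: "index formal \<Rightarrow> index formal \<Rightarrow> index formal"
    (infixl \<open>\<squnion>\<squnion>\<close> 70) where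
  "x \<squnion>\<squnion> y = inv word_map (mod_T (shuffle (word_map x) (word_map y)))"

lemma lookup_scale: "Poly_Mapping.lookup (scale c x) a = c * Poly_Mapping.lookup x a"
  unfolding scale_def by transfer (auto simp: when_def)

lemma lin_ext_superset:
  assumes "finite S" and "Poly_Mapping.keys x \<subseteq> S"
  shows "lin_ext f x = (\<Sum>a\<in>S. scale (Poly_Mapping.lookup x a) (f a))"
  unfolding lin_ext_def
  by (rule sum.mono_neutral_left)
     (use assms in \<open>auto simp: in_keys_iff poly_mapping_eq_iff fun_eq_iff lookup_scale\<close>)

lemma scale_add_left: "scale (c + d) x = scale c x + scale d x"
  and scale_diff_left: "scale (c - d) x = scale c x - scale d x"
  and scale_add_right: "scale c (x + y) = scale c x + scale c y"
  and scale_diff_right: "scale c (x - y) = scale c x - scale c y"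
  and scale_scale: "scale c (scale d x) = scale (c * d) x"
  and scale_zero: "scale 0 x = 0" "scale c 0 = 0"
  and scale_one: "scale 1 x = x"
  and scale_basis: "scale c (basis a) = Poly_Mapping.single a c"
  by (auto intro!: poly_mapping_eqI
      simp: lookup_scale lookup_add lookup_minus algebra_simps lookup_single when_def)

lemma lin_ext_add: "lin_ext f (x + y) = lin_ext f x + lin_ext f y"
proof -
  let ?S = "Poly_Mapping.keys x \<union> Poly_Mapping.keys y"
  have "finite ?S" by simp
  note e = lin_ext_superset[OF this, of _ f]
  show ?thesis
    using keys_add[of x y] by (simp add: e lookup_add scale_add_left sum.distrib)
qed

lemma lin_ext_diff: "lin_ext f (x - y) = lin_ext f x - lin_ext f y"
  using lin_ext_add[of f "x - y" y] by simp

lemma lin_ext_zero [simp]: "lin_ext f 0 = 0"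
  by (simp add: lin_ext_def)

lemma lin_ext_basis [simp]: "lin_ext f (basis a) = f a"
  by (simp add: lin_ext_def scale_one)

lemma lin_ext_fun_add: "lin_ext (\<lambda>a. f a + g a) x = lin_ext f x + lin_ext g x"
  and lin_ext_fun_diff: "lin_ext (\<lambda>a. f a - g a) x = lin_ext f x - lin_ext g x"
  by (simp_all add: lin_ext_def scale_add_right scale_diff_right sum.distrib sum_subtractf)

lemma lin_ext_id: "lin_ext basis x = x"
  by (rule poly_mapping_eqI)
     (simp add: lin_ext_def lookup_sum lookup_scale lookup_single when_def if_distrib in_keys_iff
        cong: if_cong)

lemma span_zero [simp]: "0 \<in> formal_span S"
  by (simp add: formal_span_def)

lemma span_basis: "a \<in> S \<Longrightarrow> basis a \<in> formal_span S"
  by (simp add: formal_span_def)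

lemma span_add: "x \<in> formal_span S \<Longrightarrow> y \<in> formal_span S \<Longrightarrow> x + y \<in> formal_span S"
  unfolding formal_span_def using keys_add[of x y] by auto

lemma span_diff: "x \<in> formal_span S \<Longrightarrow> y \<in> formal_span S \<Longrightarrow> x - y \<in> formal_span S"
  unfolding formal_span_def using keys_diff_subset[of x y] by auto

lemma span_scale: "x \<in> formal_span S \<Longrightarrow> scale c x \<in> formal_span S"
  unfolding formal_span_def using keys_scale[of c x] by auto

lemma span_lin_ext:
  assumes "\<And>a. a \<in> Poly_Mapping.keys x \<Longrightarrow> f a \<in> formal_span S"
  shows "lin_ext f x \<in> formal_span S"
  unfolding lin_ext_def formal_span_def
  using assms keys_sum_subset keys_scale unfolding formal_span_def by fastforce

lemma shuffle_add_left: "shuffle (x + x') y = shuffle x y + shuffle x' y"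
  and shuffle_diff_left: "shuffle (x - x') y = shuffle x y - shuffle x' y"
  and shuffle_add_right: "shuffle x (y + y') = shuffle x y + shuffle x y'"
  and shuffle_diff_right: "shuffle x (y - y') = shuffle x y - shuffle x y'"
  by (simp_all add: shuffle_def lin_ext_add lin_ext_diff lin_ext_fun_add lin_ext_fun_diff)

lemma words_Nil [simp]: "[] \<in> words"
  and words_single [simp]: "[c] \<in> words"
  by (simp_all add: words_def)

lemma words_Cons2 [simp]:
  "c # c' # w \<in> words \<longleftrightarrow> (c, c') \<notin> {(J, D), (D, J)} \<and> c' # w \<in> words"
  (is "?l \<longleftrightarrow> ?r")
proof
  assume l: ?l
  then have "((c # c' # w) ! i, (c # c' # w) ! Suc i) \<notin> {(J, D), (D, J)}"
    if "Suc i < length (c # c' # w)" for i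
    using that unfolding words_def by blast
  from this[of 0] this[of "Suc _"] show ?r by (auto simp: words_def)
qed (auto simp: words_def nth_Cons split: nat.splits)

lemma y_words_simps [simp]:
  "[] \<in> y_words"
  "c # w \<in> y_words \<longleftrightarrow> (if w = [] then c = Y else w \<in> y_words \<and> c # w \<in> words)"
  by (cases w; auto simp: y_words_def)+

lemma words_Cons_Y [simp]: "Y # w \<in> words \<longleftrightarrow> w \<in> words"
  by (cases w) auto

lemma y_words_imp_words: "w \<in> y_words \<Longrightarrow> w \<in> words"
  by (simp add: y_words_def)

lemma lcons_y_words:
  assumes "w \<in> y_words" and "w \<noteq> [] \<or> c = Y"
  shows "lcons c w \<in> y_words - {[]}"
  using assms
  by (cases "(c, w)" rule: lcons.cases) (auto split: if_splits simp: y_words_imp_words)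

lemma lconc_y_words:
  assumes "x \<in> formal_span (y_words - {[]})"
  shows "lconc c x \<in> formal_span (y_words - {[]})"
  unfolding lconc_def
proof (rule span_lin_ext)
  fix w assume "w \<in> Poly_Mapping.keys x"
  with assms have "w \<in> y_words" "w \<noteq> [] \<or> c = Y"
    by (auto simp: formal_span_def)
  then show "basis (lcons c w) \<in> formal_span (y_words - {[]})"
    by (intro span_basis lcons_y_words)
qed

lemma y_words_ConsD:
  assumes "c # w \<in> y_words"
  shows "w \<in> y_words" and "c \<noteq> Y \<Longrightarrow> w \<noteq> []"
  using assms by (auto split: if_splits)

lemma shuffle_words_y_words:
  assumes "u \<in> y_words" "v \<in> y_words" "u \<noteq> [] \<or> v \<noteq> []"
  shows "shuffle_words u v \<in> formal_span (y_words - {[]})"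
proof -
  let ?P = "\<lambda>u v. shuffle_words u v \<in> formal_span (y_words - {[]})"
  have "u \<in> y_words \<longrightarrow> v \<in> y_words \<longrightarrow> u \<noteq> [] \<or> v \<noteq> [] \<longrightarrow> ?P u v"
  proof (induction u v rule: shuffle_words.induct)
    case (1 v)
    then show ?case by (simp add: span_basis)
  next
    case (2 c u)
    then show ?case by (simp add: span_basis del: y_words_simps)
  next
    case (3 u c v)
    then show ?case
      using y_words_ConsD(1)[of Y u] by (simp add: lconc_y_words del: y_words_simps)
  next
    case ("4_1" u v)
    then show ?case
      using y_words_ConsD(1)[of Y v] by (simp add: lconc_y_words del: y_words_simps)
  next
    case ("4_2" u v)
    then show ?case
      using y_words_ConsD(1)[of Y v] by (simp add: lconc_y_words del: y_words_simps)
  next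
    case (5 u v)
    then show ?case
      using y_words_ConsD(1)[of J u] y_words_ConsD(1)[of J v]
      by (simp add: lconc_y_words span_add del: y_words_simps)
  next
    case (6 u v)
    have "D # v \<in> y_words \<Longrightarrow> D # D # v \<in> y_words" by (simp split: if_splits)
    with 6 show ?case
      using y_words_ConsD(1)[of D u]
      by (simp add: lconc_y_words span_diff del: y_words_simps)
  next
    case (7 u v)
    then show ?case
      using y_words_ConsD[of D u] y_words_ConsD(1)[of J v]
      by (simp add: lconc_y_words span_diff del: y_words_simps)
  next
    case (8 u v)
    then show ?case
      using y_words_ConsD[of J u] y_words_ConsD(1)[of D v]
      by (simp add: lconc_y_words span_diff del: y_words_simps)
  qed
  with assms show ?thesis by blast
qed

lemma shuffle_y_words:
  assumes "x \<in> formal_span y_words" and "y \<in> formal_span y_words"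
  shows "shuffle x y \<in> formal_span y_words"
proof -
  have "shuffle_words u v \<in> formal_span y_words" if "u \<in> y_words" "v \<in> y_words" for u v
    using shuffle_words_y_words[OF that] that
    by (cases "u = [] \<and> v = []") (auto simp: formal_span_def)
  moreover have "u \<in> y_words" if "u \<in> Poly_Mapping.keys x \<union> Poly_Mapping.keys y" for u
    using that assms by (auto simp: formal_span_def)
  ultimately show ?thesis
    unfolding shuffle_def by (intro span_lin_ext) simp
qed

lemma mod_T_y_words: "mod_T x \<in> formal_span y_words"
  unfolding mod_T_def by (rule span_lin_ext) (auto intro: span_basis)

lemma mod_T_id: "x \<in> formal_span y_words \<Longrightarrow> mod_T x = x"
  unfolding mod_T_def
  by (subst (2) lin_ext_id[of x, symmetric]) (rule lin_ext_cong, auto simp: formal_span_def)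

lemma L_ideal_y_words: "x \<in> L_ideal \<Longrightarrow> x \<in> formal_span y_words"
  by (induction rule: L_ideal.induct) (auto intro: span_add span_scale mod_T_y_words)

lemma L_ideal_shuffle:
  assumes "x \<in> L_ideal" and "u \<in> formal_span y_words"
  shows "shuffle u x \<in> L_ideal" and "shuffle x u \<in> L_ideal"
  using L_ideal.left[OF assms] L_ideal.right[OF assms]
  by (simp_all add: mod_T_id shuffle_y_words assms L_ideal_y_words)

lemma L_ideal_diff: "x \<in> L_ideal \<Longrightarrow> y \<in> L_ideal \<Longrightarrow> x - y \<in> L_ideal"
proof -
  have "x - y = x + scale (- 1) y"
    by (rule poly_mapping_eqI) (simp add: lookup_minus lookup_add lookup_scale)
  then show "x \<in> L_ideal \<Longrightarrow> y \<in> L_ideal \<Longrightarrow> x - y \<in> L_ideal"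
    using L_ideal.add[OF _ L_ideal.scale[of y "- 1"]] by metis
qed

lemma B_class_subset:
  assumes "x - y \<in> L_ideal"
  shows "B_class x \<subseteq> B_class y"
proof
  fix z assume "z \<in> B_class x"
  then obtain t l where "t \<in> T_span" "l \<in> L_ideal" "z = x + t + l"
    by (auto simp: B_class_def)
  then have "z = y + t + (x - y + l)" "x - y + l \<in> L_ideal"
    by (auto simp: assms L_ideal.add)
  with \<open>t \<in> T_span\<close> show "z \<in> B_class y"
    unfolding B_class_def by blast
qed

lemma B_class_eqI:
  assumes "x - y \<in> L_ideal"
  shows "B_class x = B_class y"
  using B_class_subset[OF assms] B_class_subset[of y x] L_ideal_diff[OF L_ideal.zero assms]
  by auto

lemma B_class_self: "x \<in> B_class x"
  unfolding B_class_def T_span_def using L_ideal.zero span_zero by force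

lemma B_class_y_words:
  assumes "u \<in> B_class x" "u \<in> formal_span y_words" "x \<in> formal_span y_words"
  shows "u - x \<in> L_ideal"
proof -
  obtain t l where tl: "t \<in> T_span" "l \<in> L_ideal" "u = x + t + l"
    using assms(1) by (auto simp: B_class_def)
  then have "t = u - x - l" by simp
  then have "t \<in> formal_span y_words"
    by (simp add: span_diff assms L_ideal_y_words tl(2))
  with tl(1) have "Poly_Mapping.keys t = {}"
    unfolding T_span_def formal_span_def by blast
  then have "t = 0" by simp
  with tl show ?thesis by simp
qed

lemma B_mult_class:
  assumes "x \<in> formal_span y_words" "y \<in> formal_span y_words"
  shows "B_mult (B_class x) (B_class y) = B_class (shuffle x y)"
proof -
  have "B_class (shuffle u v) = B_class (shuffle x y)"
    if "u \<in> B_class x \<inter> formal_span y_words" "v \<in> B_class y \<inter> formal_span y_words" for u v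
  proof (rule B_class_eqI)
    have "shuffle u v - shuffle x y = shuffle (u - x) v + shuffle x (v - y)"
      by (simp add: shuffle_diff_left shuffle_diff_right)
    moreover have "u - x \<in> L_ideal" "v - y \<in> L_ideal"
      using that assms by (auto intro: B_class_y_words)
    ultimately show "shuffle u v - shuffle x y \<in> L_ideal"
      using that assms L_ideal.add[OF L_ideal_shuffle(2)[of "u - x" v] L_ideal_shuffle(1)[of "v - y" x]]
      by simp
  qed
  moreover have "x \<in> B_class x \<inter> formal_span y_words" "y \<in> B_class y \<inter> formal_span y_words"
    using assms B_class_self by auto
  ultimately show ?thesis unfolding B_mult_def by blast
qed

lemma index_word_Nil [simp]: "index_word [] = []"
  and index_word_snoc [simp]: "index_word (k @ [a]) = jpow a @ Y # index_word k"
  by (simp_all add: index_word_def)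

lemma jpow_replicate:
  "jpow (int n) = replicate n J" "jpow (- int n) = replicate n D"
  by (simp_all add: jpow_def)

lemma replicate_y_words:
  assumes "w \<in> y_words"
  shows "replicate n c @ Y # w \<in> y_words"
proof (induction n)
  case 0
  show ?case using assms by (simp add: y_words_imp_words)
next
  case (Suc n)
  have "replicate n c @ Y # w \<in> words" using Suc y_words_imp_words by blast
  then have "c # replicate n c @ Y # w \<in> words" by (cases n) simp_all
  with Suc show ?case by simp
qed

lemma index_word_y_words: "index_word k \<in> y_words"
  by (induction k rule: rev_induct) (auto simp: jpow_def replicate_y_words simp del: y_words_simps(2))

lemma y_words_index_word: "w \<in> y_words \<Longrightarrow> \<exists>k. w = index_word k"
proof (induction w)
  case Nil
  then show ?case using index_word_Nil by metis
next
  case (Cons c w)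
  then obtain k where k: "w = index_word k" using y_words_ConsD(1) by blast
  show ?case
  proof (cases "c = Y")
    case True
    then have "c # w = index_word (k @ [0])" by (simp add: k jpow_def)
    then show ?thesis ..
  next
    case False
    with Cons.prems have "w \<noteq> []" using y_words_ConsD(2) by blast
    with k obtain k' a where k': "k = k' @ [a]" by (metis index_word_Nil rev_exhaust)
    have r: "c # w \<in> words" using Cons.prems y_words_imp_words by blast
    obtain n where n: "a = int n \<or> a = - int n" by (metis int_cases2)
    have "\<exists>b. c # jpow a = jpow b"
    proof (cases n)
      case 0
      with n False have "c # jpow a = jpow 1 \<or> c # jpow a = jpow (- 1)"
        by (cases c) (auto simp: jpow_def)
      then show ?thesis by blast
    next
      case (Suc m)
      with n False r have "c # jpow a = jpow (int (Suc n)) \<or> c # jpow a = jpow (- int (Suc n))"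
        unfolding k k' index_word_snoc
        by (cases c) (auto simp only: jpow_replicate replicate_Suc append_Cons words_Cons2
            insert_iff prod.inject simp_thms letter.distinct)
      then show ?thesis by blast
    qed
    then obtain b where "c # jpow a = jpow b" ..
    then have "c # w = index_word (k' @ [b])"
      unfolding k k' index_word_snoc by (metis append_Cons)
    then show ?thesis ..
  qed
qed

lemma word_map_y_words: "word_map x \<in> formal_span y_words"
  unfolding word_map_def by (rule span_lin_ext) (simp add: span_basis index_word_y_words)

lemma word_map_surj:
  assumes "s \<in> formal_span y_words"
  shows "s \<in> range word_map"
proof -
  obtain g where g: "\<And>w. w \<in> y_words \<Longrightarrow> index_word (g w) = w"
    using y_words_index_word by metis
  have "word_map (\<Sum>w\<in>S. scale (c w) (basis (g w))) = (\<Sum>w\<in>S. scale (c w) (basis w))"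
    if "finite S" "S \<subseteq> y_words" for S c
    using that
  proof (induction S rule: finite_induct)
    case (insert w S)
    have "word_map (scale (c w) (basis (g w))) = scale (c w) (basis w)"
      using insert.prems by (cases "c w = 0") (simp_all add: word_map_def lin_ext_def scale_basis g)
    with insert show ?case by (simp add: word_map_def lin_ext_add)
  qed (simp add: word_map_def)
  from this[of "Poly_Mapping.keys s" "Poly_Mapping.lookup s"]
  have "word_map (lin_ext (\<lambda>w. basis (g w)) s) = lin_ext basis s"
    using assms by (simp add: lin_ext_def formal_span_def)
  then show ?thesis by (metis lin_ext_id rangeI)
qed

lemma jpow_append_eq:
  assumes "jpow a @ Y # w = jpow b @ Y # w'"
  shows "a = b \<and> w = w'"
proof -
  have t: "takeWhile (\<lambda>c. c \<noteq> Y) (jpow a @ Y # w) = jpow a" for a w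
    by (subst takeWhile_append2) (auto simp: jpow_def split: if_splits)
  have "jpow a = jpow b" using t[of a w] t[of b w'] assms by simp
  moreover have "a = b" if "jpow a = jpow b"
    using that by (auto simp: jpow_def replicate_eq_replicate split: if_splits)
  ultimately show ?thesis using assms by simp
qed

lemma index_word_inj: "index_word k = index_word k' \<Longrightarrow> k = k'"
proof (induction k arbitrary: k' rule: rev_induct)
  case Nil
  then show ?case by (cases k' rule: rev_cases) auto
next
  case (snoc a k)
  then show ?case by (cases k' rule: rev_cases) (auto dest: jpow_append_eq)
qed

lemma lookup_word_map: "Poly_Mapping.lookup (word_map x) (index_word k) = Poly_Mapping.lookup x k"
proof -
  have "index_word a = index_word k \<longleftrightarrow> a = k" for a using index_word_inj by blast
  then show ?thesis
    by (simp add: word_map_def lin_ext_def lookup_sum lookup_scale lookup_single when_def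
        if_distrib in_keys_iff cong: if_cong)
qed

lemma word_map_inj: "inj word_map"
  by (rule injI) (metis lookup_word_map poly_mapping_eqI)

lemma phi_index_shuffle: "phi (x \<squnion>\<squnion> y) = B_mult (phi x) (phi y)"
proof -
  let ?s = "shuffle (word_map x) (word_map y)"
  have s: "?s \<in> formal_span y_words" by (simp add: shuffle_y_words word_map_y_words)
  then have "word_map (x \<squnion>\<squnion> y) = ?s"
    by (simp add: index_shuffle_def mod_T_id f_inv_into_f word_map_surj)
  then show ?thesis by (simp add: phi_def B_mult_class word_map_y_words)
qed

lemma phi_not_inj: "phi (basis [0, - 1]) = phi (scale 2 (basis [- 1, 0]))"
proof -
  have w: "word_map (basis [0, - 1]) = basis [D, Y, Y]"
    "word_map (scale 2 (basis [- 1, 0])) = scale 2 (basis [Y, D, Y])"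
    by (simp_all add: word_map_def index_word_def jpow_def scale_basis) (simp add: lin_ext_def scale_basis index_word_def jpow_def)
  have "mod_T (lconc D (shuffle_words [Y] [Y]) - shuffle_words (lcons D [Y]) [Y]
      - shuffle_words [Y] (lcons D [Y])) \<in> L_ideal"
    by (rule L_ideal.leibniz) auto
  moreover have "lconc D (shuffle_words [Y] [Y]) - shuffle_words (lcons D [Y]) [Y]
      - shuffle_words [Y] (lcons D [Y]) = basis [D, Y, Y] - scale 2 (basis [Y, D, Y])"
    using scale_add_left[of 1 1 "basis [Y, D, Y]"] by (simp add: lconc_def scale_one)
  moreover have "basis [D, Y, Y] - scale 2 (basis [Y, D, Y]) \<in> formal_span y_words"
    by (intro span_diff span_scale span_basis) auto
  ultimately have "basis [D, Y, Y] - scale 2 (basis [Y, D, Y]) \<in> L_ideal"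
    by (simp add: mod_T_id)
  then show ?thesis unfolding phi_def w by (rule B_class_eqI)
qed

end

(* Sending a word to the power series Li obtained by letting j divide the n-th coefficient by n, d be
   z d/dz, and y be multiplication by z/(1 - z) turns the shuffle product into the product of power
   series and kills L_ideal (integration by parts and the Leibniz rule). Summing the powers of the
   variable of a nonpositive entry by Faulhaber's formula gives Li k = Li (reduce k), so the
   positive-index map does not change Li. Both sides of the claim therefore have the same Li and are
   combinations of positive indices, on which Li is injective. *)
theory Submission
  imports
    Defs
    "HOL-Computational_Algebra.Polynomial_Factorial"
    "HOL-Computational_Algebra.Field_as_Ring"
begin

unbundle fps_syntax

section \<open>Polylogarithms of words\<close>

text \<open>The map \<open>phi\<close> is not injective, so a product in the quotient has many
  preimages; since \<open>li_index\<close> depends only on the class, all admissible ones are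
  settled at once. Injectivity of \<open>li_index\<close> fails on general indices: a nonpositive
  entry inserts a polynomial in its summation variable, polynomials have polynomial antidifferences,
  and these produce the relations behind \<open>reduce\<close>. For positive entries the obstruction
  is that a nonzero combination of 1/x^a with a > 0 is not a difference R(x+1) - R(x) of a rational
  function R. To let this act by induction on the set of indices, independence is proved for
  truncated sums with polynomial coefficients, although only constant ones are wanted. Comparing
  both sides also requires that products of admissible indices stay admissible and products of
  positive ones positive; both are read off from the letters of the words.\<close>

definition lin_eval :: "('a \<Rightarrow> rat fps) \<Rightarrow> 'a formal \<Rightarrow> rat fps" where
  "lin_eval f x = (\<Sum>a\<in>Poly_Mapping.keys x. fps_const (Poly_Mapping.lookup x a) * f a)"

lemma lin_eval_superset:
  assumes "finite S" and "Poly_Mapping.keys x \<subseteq> S"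
  shows "lin_eval f x = (\<Sum>a\<in>S. fps_const (Poly_Mapping.lookup x a) * f a)"
  unfolding lin_eval_def
  by (rule sum.mono_neutral_left) (use assms in \<open>auto simp: in_keys_iff\<close>)

lemma lin_eval_zero [simp]: "lin_eval f 0 = 0"
  by (simp add: lin_eval_def)

lemma lin_eval_basis [simp]: "lin_eval f (basis a) = f a"
  by (simp add: lin_eval_def)

lemma lin_eval_add: "lin_eval f (x + y) = lin_eval f x + lin_eval f y"
  using lin_eval_superset[of "Poly_Mapping.keys x \<union> Poly_Mapping.keys y" x f]
    lin_eval_superset[of "Poly_Mapping.keys x \<union> Poly_Mapping.keys y" y f]
    lin_eval_superset[of "Poly_Mapping.keys x \<union> Poly_Mapping.keys y" "x + y" f] keys_add[of x y]
  by (simp add: lookup_add sum.distrib distrib_right fps_const_add[symmetric] del: fps_const_add)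

lemma lin_eval_diff: "lin_eval f (x - y) = lin_eval f x - lin_eval f y"
  using lin_eval_add[of f "x - y" y] by simp

lemma lin_eval_scale: "lin_eval f (scale c x) = fps_const c * lin_eval f x"
  using lin_eval_superset[of "Poly_Mapping.keys x" "scale c x" f] keys_scale[of c x]
  by (simp add: lin_eval_def lookup_scale sum_distrib_left fps_const_mult[symmetric] mult.assoc
      del: fps_const_mult)

lemma lin_eval_sum: "lin_eval f (sum g S) = (\<Sum>i\<in>S. lin_eval f (g i))"
  by (induction S rule: infinite_finite_induct) (auto simp: lin_eval_add)

lemma lin_eval_lin_ext: "lin_eval f (lin_ext g x) = lin_eval (\<lambda>a. lin_eval f (g a)) x"
  by (simp add: lin_ext_def lin_eval_sum lin_eval_scale lin_eval_def[of _ x])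

lemma lin_eval_cong: "(\<And>a. a \<in> Poly_Mapping.keys x \<Longrightarrow> f a = g a) \<Longrightarrow> lin_eval f x = lin_eval g x"
  by (simp add: lin_eval_def)

lemma lin_eval_linear:
  fixes x :: "'a formal"
  assumes "\<And>f g. F (f + g) = F f + F g" and "\<And>c f. F (fps_const c * f) = fps_const c * F f"
  shows "F (lin_eval f x) = lin_eval (\<lambda>a. F (f a)) x"
proof -
  have "F 0 = 0" using assms(2)[of 0 0] by simp
  then have "F (sum g S) = (\<Sum>i\<in>S. F (g i))" for g :: "'a \<Rightarrow> rat fps" and S
    by (induction S rule: infinite_finite_induct) (auto simp: assms(1))
  then show ?thesis by (simp add: lin_eval_def assms(2))
qed

section \<open>Operators of the letters on power series\<close>

definition theta :: "rat fps \<Rightarrow> rat fps" where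
  "theta f = fps_X * fps_deriv f"

text \<open>The constant term is sent to \<open>x / 0 = 0\<close>, in accordance with \<open>mod_T\<close> killing the word \<open>j\<close>.\<close>

definition theta_inv :: "rat fps \<Rightarrow> rat fps" where
  "theta_inv f = Abs_fps (\<lambda>n. f $ n / of_nat n)"

definition geo :: "rat fps" where
  "geo = Abs_fps (\<lambda>n. if n = 0 then 0 else 1)"

lemma nth_theta [simp]: "theta f $ n = of_nat n * f $ n"
  by (cases n) (simp_all add: theta_def)

lemma nth_theta_inv [simp]: "theta_inv f $ n = f $ n / of_nat n"
  by (simp add: theta_inv_def)

lemma geo_nth_0 [simp]: "geo $ 0 = 0"
  by (simp add: geo_def)

lemma nth_geo_mult [simp]: "(geo * f) $ n = (\<Sum>i<n. f $ i)"
proof -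
  have "(f * geo) $ n = (\<Sum>i\<le>n. if i < n then f $ i else 0)"
    unfolding fps_mult_nth atLeast0AtMost by (rule sum.cong) (auto simp: geo_def)
  also have "\<dots> = (\<Sum>i<n. f $ i)"
    by (rule sum.mono_neutral_cong_right) auto
  finally show ?thesis by (simp add: mult.commute)
qed

lemma theta_mult: "theta (f * g) = theta f * g + f * theta g"
  by (simp add: theta_def algebra_simps)

lemma theta_theta_inv: "f $ 0 = 0 \<Longrightarrow> theta (theta_inv f) = f"
  and theta_inv_theta: "f $ 0 = 0 \<Longrightarrow> theta_inv (theta f) = f"
  by (rule fps_ext, case_tac "n = 0"; simp)+

fun letter_op :: "letter \<Rightarrow> rat fps \<Rightarrow> rat fps" where
  "letter_op J f = theta_inv f"
| "letter_op D f = theta f"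
| "letter_op Y f = geo * f"

lemma letter_op_linear:
  "letter_op c (f + g) = letter_op c f + letter_op c g"
  "letter_op c (f - g) = letter_op c f - letter_op c g"
  "letter_op c (fps_const a * f) = fps_const a * letter_op c f"
  by (cases c; auto intro!: fps_ext simp: algebra_simps add_divide_distrib diff_divide_distrib
      sum.distrib sum_subtractf sum_distrib_left simp flip: fps_const_mult)+

definition li_word :: "letter list \<Rightarrow> rat fps" where
  "li_word w = foldr letter_op w 1"

lemma li_word_simps [simp]: "li_word [] = 1" "li_word (c # w) = letter_op c (li_word w)"
  by (simp_all add: li_word_def)

lemma li_word_nth_0: "w \<in> y_words \<Longrightarrow> w \<noteq> [] \<Longrightarrow> li_word w $ 0 = 0"
proof (cases w)
  case (Cons c w')
  then show ?thesis by (cases c) (simp_all del: y_words_simps)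
qed simp

text \<open>After a cancellation the remaining word still ends in \<open>Y\<close>, so its series
  has no constant term, and there \<open>theta\<close> and \<open>theta_inv\<close> undo each
  other.\<close>

lemma li_word_lcons:
  assumes "w \<in> y_words" and "w \<noteq> [] \<or> c = Y"
  shows "li_word (lcons c w) = letter_op c (li_word w)"
  using assms
  by (cases "(c, w)" rule: lcons.cases)
    (auto split: if_splits simp: li_word_nth_0 theta_theta_inv theta_inv_theta)

lemma li_lconc:
  assumes "x \<in> formal_span (y_words - {[]}) \<or> c = Y \<and> x \<in> formal_span y_words"
  shows "lin_eval li_word (lconc c x) = letter_op c (lin_eval li_word x)"
proof -
  have "lin_eval li_word (lconc c x) = lin_eval (\<lambda>w. letter_op c (li_word w)) x"
    unfolding lconc_def lin_eval_lin_ext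
    by (rule lin_eval_cong) (use assms in \<open>auto simp: formal_span_def intro!: li_word_lcons\<close>)
  also have "\<dots> = letter_op c (lin_eval li_word x)"
    by (rule lin_eval_linear[symmetric]) (simp_all add: letter_op_linear)
  finally show ?thesis .
qed

lemma li_mod_T_lconc:
  assumes "x \<in> formal_span y_words"
  shows "lin_eval li_word (mod_T (lconc c x)) = letter_op c (lin_eval li_word x)"
proof -
  have "lin_eval li_word (mod_T (basis (lcons c w))) = letter_op c (li_word w)" if "w \<in> y_words" for w
  proof (cases "w \<noteq> [] \<or> c = Y")
    case True
    then show ?thesis
      using lcons_y_words[of w c] li_word_lcons[of w c] that by (auto simp: mod_T_def)
  next
    case False
    \<comment> \<open>\<open>mod_T\<close> discards the one-letter words \<open>[J]\<close> and
      \<open>[D]\<close>; accordingly their operators annihilate the constant series 1.\<close>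
    moreover have "letter_op c 1 = 0" if "c \<noteq> Y"
      using that by (cases c) (auto intro!: fps_ext)
    ultimately show ?thesis by (simp add: mod_T_def)
  qed
  then have "lin_eval li_word (mod_T (lconc c x)) = lin_eval (\<lambda>w. letter_op c (li_word w)) x"
    using assms unfolding lconc_def mod_T_def
    by (subst lin_eval_lin_ext, subst lin_eval_lin_ext) (auto intro!: lin_eval_cong simp: formal_span_def)
  also have "\<dots> = letter_op c (lin_eval li_word x)"
    by (rule lin_eval_linear[symmetric]) (simp_all add: letter_op_linear)
  finally show ?thesis .
qed

text \<open>The product rule of \<open>theta\<close> is applied to the two antiderivatives and
  integrated back; their product has no constant term, so nothing is lost.\<close>

lemma theta_inv_mult:
  assumes "f $ 0 = 0" "g $ 0 = 0"
  shows "theta_inv f * theta_inv g = theta_inv (f * theta_inv g) + theta_inv (theta_inv f * g)"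
proof -
  have "theta_inv f * theta_inv g = theta_inv (theta (theta_inv f * theta_inv g))"
    by (simp add: theta_inv_theta)
  also have "\<dots> = theta_inv (f * theta_inv g + theta_inv f * g)"
    by (simp add: theta_mult theta_theta_inv assms)
  also have "\<dots> = theta_inv (f * theta_inv g) + theta_inv (theta_inv f * g)"
    using letter_op_linear(1)[of J] by simp
  finally show ?thesis .
qed

text \<open>Each rule of the recursion is an operator identity: multiplication by \<open>geo\<close>
  can be pulled out, two letters \<open>J\<close> integrate by parts, and a rule with a
  \<open>D\<close> is the product rule of \<open>theta\<close> solved for one term, where
  \<open>theta\<close> cancels a \<open>J\<close> in front of the other factor.\<close>

lemma li_shuffle_words:
  assumes "u \<in> y_words" "v \<in> y_words"
  shows "lin_eval li_word (shuffle_words u v) = li_word u * li_word v"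
proof -
  have S: "shuffle_words u v \<in> formal_span y_words" if "u \<in> y_words" "v \<in> y_words" for u v
    using shuffle_words_y_words[OF that] that
    by (cases "u = [] \<and> v = []") (auto simp: formal_span_def)
  have "u \<in> y_words \<longrightarrow> v \<in> y_words \<longrightarrow> lin_eval li_word (shuffle_words u v) = li_word u * li_word v"
  proof (induction u v rule: shuffle_words.induct)
    case (1 v)
    then show ?case by simp
  next
    case (2 c u)
    then show ?case by simp
  next
    case (3 u c v)
    then show ?case
      using y_words_ConsD(1)[of Y u] by (simp add: li_lconc S mult_ac del: y_words_simps)
  next
    case ("4_1" u v)
    then show ?case
      using y_words_ConsD(1)[of Y v] by (simp add: li_lconc S mult_ac del: y_words_simps)
  next
    case ("4_2" u v)
    then show ?case
      using y_words_ConsD(1)[of Y v] by (simp add: li_lconc S mult_ac del: y_words_simps)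
  next
    case (5 u v)
    show ?case
    proof (intro impI)
      assume uv: "J # u \<in> y_words" "J # v \<in> y_words"
      note y = y_words_ConsD[OF uv(1)] y_words_ConsD[OF uv(2)]
      have "li_word u $ 0 = 0" "li_word v $ 0 = 0" using y by (auto intro: li_word_nth_0)
      with 5 uv y show "lin_eval li_word (shuffle_words (J # u) (J # v)) = li_word (J # u) * li_word (J # v)"
        by (simp add: li_lconc shuffle_words_y_words lin_eval_add theta_inv_mult del: y_words_simps)
    qed
  next
    case (6 u v)
    have "D # v \<in> y_words \<Longrightarrow> D # D # v \<in> y_words" by (simp split: if_splits)
    with 6 show ?case
      using y_words_ConsD[of D u]
      by (auto simp: li_lconc shuffle_words_y_words lin_eval_diff theta_mult simp del: y_words_simps)
  next
    case (7 u v)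
    show ?case
    proof (intro impI)
      assume uv: "D # u \<in> y_words" "J # v \<in> y_words"
      note y = y_words_ConsD[OF uv(1)] y_words_ConsD[OF uv(2)]
      have "li_word u $ 0 = 0" "li_word v $ 0 = 0" using y by (auto intro: li_word_nth_0)
      with 7 uv y show "lin_eval li_word (shuffle_words (D # u) (J # v)) = li_word (D # u) * li_word (J # v)"
        by (simp add: li_lconc shuffle_words_y_words lin_eval_diff theta_mult theta_theta_inv del: y_words_simps)
    qed
  next
    case (8 u v)
    show ?case
    proof (intro impI)
      assume uv: "J # u \<in> y_words" "D # v \<in> y_words"
      note y = y_words_ConsD[OF uv(1)] y_words_ConsD[OF uv(2)]
      have "li_word u $ 0 = 0" "li_word v $ 0 = 0" using y by (auto intro: li_word_nth_0)
      with 8 uv y show "lin_eval li_word (shuffle_words (J # u) (D # v)) = li_word (J # u) * li_word (D # v)"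
        by (simp add: li_lconc shuffle_words_y_words lin_eval_diff theta_mult theta_theta_inv del: y_words_simps)
    qed
  qed
  with assms show ?thesis by blast
qed

lemma li_shuffle:
  assumes "x \<in> formal_span y_words" "y \<in> formal_span y_words"
  shows "lin_eval li_word (shuffle x y) = lin_eval li_word x * lin_eval li_word y"
proof -
  have "lin_eval li_word (shuffle x y) = lin_eval (\<lambda>u. lin_eval (\<lambda>v. li_word u * li_word v) y) x"
    using assms unfolding shuffle_def lin_eval_lin_ext
    by (intro lin_eval_cong) (auto simp: formal_span_def intro!: li_shuffle_words)
  also have "\<dots> = lin_eval (\<lambda>u. li_word u * lin_eval li_word y) x"
    by (simp add: lin_eval_def[of _ y] sum_distrib_left mult_ac)
  also have "\<dots> = lin_eval li_word x * lin_eval li_word y"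
    by (simp add: lin_eval_def[of _ x] sum_distrib_right mult.assoc)
  finally show ?thesis .
qed

lemma li_L_ideal: "x \<in> L_ideal \<Longrightarrow> lin_eval li_word x = 0"
proof (induction rule: L_ideal.induct)
  case (left x u)
  then show ?case by (simp add: mod_T_id shuffle_y_words L_ideal_y_words li_shuffle)
next
  case (right x u)
  then show ?case by (simp add: mod_T_id shuffle_y_words L_ideal_y_words li_shuffle)
next
  case (conc x c)
  then show ?case
    using letter_op_linear(3)[of c 0 0] by (simp add: li_mod_T_lconc L_ideal_y_words)
next
  case (leibniz u v)
  have y: "u \<in> y_words" "v \<in> y_words" using leibniz by (simp_all add: y_words_def)
  with leibniz have d: "lcons D u \<in> y_words" "lcons D v \<in> y_words" using lcons_y_words by auto
  \<comment> \<open>For the letter \<open>D\<close>, \<open>li_lconc\<close> needs the empty word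
    excluded, hence the smaller span.\<close>
  have S: "shuffle_words u v \<in> formal_span (y_words - {[]})"
    "shuffle_words (lcons D u) v \<in> formal_span (y_words - {[]})"
    "shuffle_words u (lcons D v) \<in> formal_span (y_words - {[]})"
    using leibniz y d by (simp_all add: shuffle_words_y_words)
  then have "lconc D (shuffle_words u v) - shuffle_words (lcons D u) v - shuffle_words u (lcons D v)
      \<in> formal_span (y_words - {[]})"
    by (intro span_diff lconc_y_words)
  then have "lconc D (shuffle_words u v) - shuffle_words (lcons D u) v - shuffle_words u (lcons D v)
      \<in> formal_span y_words"
    by (auto simp: formal_span_def)
  with S y d leibniz show ?case
    by (simp add: mod_T_id lin_eval_diff li_lconc li_shuffle_words li_word_lcons theta_mult)
qed (simp_all add: lin_eval_add lin_eval_scale)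

section \<open>Polylogarithms of indices and the positive-index map\<close>

text \<open>Faulhaber's formula, read off at degree p + 1: \<open>b\<close> stands for the
  exponential generating function of Bernoulli numbers and \<open>S\<close> for a sum of
  exponentials, so that \<open>fact p * S $ p\<close> is a power sum. Leaving \<open>b\<close>
  abstract serves both sign conventions.\<close>

lemma power_sum_from_gf:
  fixes b S :: "rat fps"
  assumes "b * (fps_exp (of_nat n) - 1) = fps_X * S"
  shows "fact p * S $ p = 1 / of_nat (Suc p) *
    (\<Sum>i=0..p. of_nat (Suc p choose i) * (fact i * b $ i) * of_nat n ^ (Suc p - i))"
proof -
  let ?e = "fps_exp (of_nat n) - 1 :: rat fps"
  have "S $ p = (b * ?e) $ Suc p" by (simp add: assms)
  also have "\<dots> = (\<Sum>i=0..Suc p. b $ i * ?e $ (Suc p - i))" by (rule fps_mult_nth)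
  \<comment> \<open>The term \<open>i = Suc p\<close> drops out because \<open>?e\<close> has no
    constant term.\<close>
  also have "\<dots> = (\<Sum>i=0..p. b $ i * ?e $ (Suc p - i))" by simp
  also have "\<dots> = (\<Sum>i=0..p. b $ i * (of_nat n ^ (Suc p - i) / fact (Suc p - i)))"
    by (rule sum.cong) auto
  finally have "fact p * S $ p = (\<Sum>i=0..p. fact p * (b $ i * (of_nat n ^ (Suc p - i) / fact (Suc p - i))))"
    by (simp add: sum_distrib_left)
  also have "\<dots> = (\<Sum>i=0..p. 1 / of_nat (Suc p) *
      (of_nat (Suc p choose i) * (fact i * b $ i) * of_nat n ^ (Suc p - i)))"
  proof (rule sum.cong)
    fix i assume "i \<in> {0..p}"
    then have "(of_nat (Suc p choose i) :: rat) = of_nat (Suc p) * fact p / (fact i * fact (Suc p - i))"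
      using binomial_fact[of i "Suc p", where 'a = rat] by simp
    moreover have "(of_nat (Suc p) :: rat) \<noteq> 0" by (rule of_nat_neq_0)
    ultimately show "fact p * (b $ i * (of_nat n ^ (Suc p - i) / fact (Suc p - i))) = 1 / of_nat (Suc p) *
      (of_nat (Suc p choose i) * (fact i * b $ i) * of_nat n ^ (Suc p - i))"
      by (simp del: of_nat_Suc)
  qed simp
  finally show ?thesis by (simp only: sum_distrib_left)
qed

lemma sum_fps_exp:
  "(\<Sum>i<n. fps_exp (of_nat i)) * (fps_exp 1 - 1) = (fps_exp (of_nat n) - 1 :: rat fps)"
  by (induction n) (simp_all add: algebra_simps fps_exp_add_mult)

lemma mult_eq_cross:
  fixes a c x s :: "'a :: comm_semiring_1"
  assumes "a * c = x" and "s * c = r"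
  shows "a * r = x * s"
  using assms by (auto simp: mult_ac)

lemma power_sum_bernoulli_minus:
  "(\<Sum>i<n. (of_nat i :: rat) ^ p) = 1 / of_nat (Suc p) *
    (\<Sum>i=0..p. of_nat (Suc p choose i) * bernoulli_minus i * of_nat n ^ (Suc p - i))"
proof -
  let ?S = "\<Sum>i<n. fps_exp (of_nat i) :: rat fps"
  have "fps_X / (fps_exp 1 - 1) * (fps_exp (of_nat n) - 1) = fps_X * ?S"
    by (rule mult_eq_cross[OF bernoulli_minus_gf sum_fps_exp])
  from power_sum_from_gf[OF this, of p] show ?thesis
    by (simp add: bernoulli_minus_def fps_sum_nth sum_distrib_left)
qed

text \<open>The factor \<open>1 - fps_exp (-1)\<close> telescopes sums from 1 to n, whereas
  \<open>fps_exp 1 - 1\<close> telescopes sums from 0 to n - 1. Hence a right neighbour n, with j <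
  n, takes \<open>bernoulli_minus\<close>, and a left neighbour l, with j \<le> l, takes
  \<open>bernoulli_plus\<close>.\<close>

lemma power_sum_bernoulli_plus:
  "(\<Sum>i=1..n. (of_nat i :: rat) ^ p) = 1 / of_nat (Suc p) *
    (\<Sum>i=0..p. of_nat (Suc p choose i) * bernoulli_plus i * of_nat n ^ (Suc p - i))"
proof -
  let ?S = "\<Sum>i=1..n. fps_exp (of_nat i) :: rat fps"
  have "?S * (1 - fps_exp (-1)) = fps_exp (of_nat n) - 1"
  proof (induction n)
    case (Suc n)
    have "fps_exp (of_nat (Suc n)) * fps_exp (- 1) = (fps_exp (of_nat n) :: rat fps)"
      by (simp flip: fps_exp_add_mult)
    with Suc show ?case by (simp add: algebra_simps del: of_nat_Suc)
  qed simp
  then have "fps_X / (1 - fps_exp (-1)) * (fps_exp (of_nat n) - 1) = fps_X * ?S"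
    by (rule mult_eq_cross[OF bernoulli_plus_gf])
  from power_sum_from_gf[OF this, of p] show ?thesis
    by (simp add: bernoulli_plus_def fps_sum_nth sum_distrib_left)
qed

section \<open>Coefficients of the polylogarithms of indices\<close>

definition li_index :: "index \<Rightarrow> rat fps" where
  "li_index k = li_word (index_word k)"

lemma li_index_Nil [simp]: "li_index [] = 1"
  by (simp add: li_index_def)

lemma li_word_jpow:
  assumes "li_word w $ 0 = 0"
  shows "li_word (jpow a @ w) $ n = of_nat n powi (- a) * li_word w $ n"
proof (cases "n = 0")
  case True
  have "li_word (replicate m c @ w) $ 0 = 0" if "c \<noteq> Y" for m c
    using that assms by (induction m) (cases c; simp)+
  with True assms show ?thesis by (simp add: jpow_def)
next
  case False
  have "li_word (replicate m J @ w) $ n = li_word w $ n / of_nat n ^ m"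
    "li_word (replicate m D @ w) $ n = of_nat n ^ m * li_word w $ n" for m
    by (induction m) auto
  with False show ?thesis by (simp add: jpow_def power_int_def field_simps)
qed

text \<open>Peels off the largest summation variable, which the coefficient of z^n fixes to n;
  iterating gives the nested sum over 0 < n_1 < ... < n_r = n.\<close>

lemma li_index_snoc:
  "li_index (k @ [a]) $ n = of_nat n powi (- a) * (\<Sum>i<n. li_index k $ i)"
  by (simp add: li_index_def li_word_jpow)

text \<open>The trailing entries act as a linear operator, so the reduction need only be checked
  when exactly one entry follows the nonpositive one.\<close>

lemma li_index_append:
  "li_index (u @ v) = foldr letter_op (index_word v) (li_index u)"
  by (simp add: li_index_def li_word_def index_word_def)

lemma foldr_letter_op_linear:
  "foldr letter_op w (f + g) = foldr letter_op w f + foldr letter_op w g"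
  "foldr letter_op w (f - g) = foldr letter_op w f - foldr letter_op w g"
  "foldr letter_op w (fps_const a * f) = fps_const a * foldr letter_op w f"
  by (induction w) (simp_all add: letter_op_linear)

text \<open>Interchanges the sums over l < j < n and writes the inner range as a difference of
  initial segments, each having its own Bernoulli formula.\<close>

lemma sum_lessThan_triangle:
  fixes g :: "nat \<Rightarrow> rat"
  shows "(\<Sum>j<n. g j * (\<Sum>l<j. c l)) = (\<Sum>l<n. c l * ((\<Sum>j<n. g j) - (\<Sum>j\<le>l. g j)))"
  by (induction n) (simp_all add: algebra_simps sum.distrib sum_subtractf sum_distrib_left lessThan_Suc_atMost[symmetric])

lemma power_int_diff_nat:
  fixes x :: rat
  assumes "x \<noteq> 0" and "i \<le> p"
  shows "x powi (- (b - int p - 1 + int i)) = x powi (- b) * x ^ (Suc p - i)"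
proof -
  have "- (b - int p - 1 + int i) = - b + int (Suc p - i)" using assms(2) by simp
  then show ?thesis using assms(1) by (metis power_int_add power_int_of_nat)
qed

text \<open>The power n^(p+1-i) in Faulhaber's formula is absorbed into the exponent of the right
  neighbour, turning b into b - p - 1 + i.\<close>

lemma li_index_merge_right:
  "(\<Sum>i=0..p. of_nat (Suc p choose i) * bernoulli_minus i * li_index (u @ [b - int p - 1 + int i]) $ n)
    = of_nat (Suc p) * of_nat n powi (- b) * (\<Sum>l<n. li_index u $ l) * (\<Sum>j<n. of_nat j ^ p)"
proof (cases "n = 0")
  case False
  have "(\<Sum>i=0..p. of_nat (Suc p choose i) * bernoulli_minus i * li_index (u @ [b - int p - 1 + int i]) $ n)
    = (\<Sum>i=0..p. of_nat n powi (- b) * (\<Sum>l<n. li_index u $ l) *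
        (of_nat (Suc p choose i) * bernoulli_minus i * of_nat n ^ (Suc p - i)))"
    using False power_int_diff_nat[of "of_nat n" _ p b]
    by (intro sum.cong) (auto simp: li_index_snoc)
  also have "\<dots> = of_nat n powi (- b) * (\<Sum>l<n. li_index u $ l) * (of_nat (Suc p) * (\<Sum>j<n. of_nat j ^ p))"
    unfolding power_sum_bernoulli_minus sum_distrib_left[symmetric] by (simp del: of_nat_Suc)
  finally show ?thesis by (simp add: mult_ac del: of_nat_Suc)
qed (simp add: li_index_snoc)

lemma li_index_merge_left:
  "(\<Sum>i=0..p. of_nat (Suc p choose i) * bernoulli_plus i * li_index (u @ [d - int p - 1 + int i]) $ l)
    = of_nat (Suc p) * li_index (u @ [d]) $ l * (\<Sum>j=1..l. of_nat j ^ p)"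
proof (cases "l = 0")
  case False
  have "(\<Sum>i=0..p. of_nat (Suc p choose i) * bernoulli_plus i * li_index (u @ [d - int p - 1 + int i]) $ l)
    = (\<Sum>i=0..p. li_index (u @ [d]) $ l *
        (of_nat (Suc p choose i) * bernoulli_plus i * of_nat l ^ (Suc p - i)))"
    using False power_int_diff_nat[of "of_nat l" _ p d]
    by (intro sum.cong) (auto simp: li_index_snoc)
  also have "\<dots> = li_index (u @ [d]) $ l * (of_nat (Suc p) * (\<Sum>j=1..l. of_nat j ^ p))"
    unfolding power_sum_bernoulli_plus sum_distrib_left[symmetric] by (simp del: of_nat_Suc)
  finally show ?thesis by (simp add: mult_ac del: of_nat_Suc)
qed (simp add: li_index_snoc)

text \<open>The sum over the summation variable of a nonpositive entry \<open>-p\<close>, which runs strictly between its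
  neighbours \<open>l\<close> and \<open>n\<close>.\<close>

lemma li_index_nonpos_nth:
  "li_index (u @ [- int p, b]) $ n = of_nat n powi (- b) *
    (\<Sum>l<n. li_index u $ l * ((\<Sum>j<n. of_nat j ^ p) - (\<Sum>j=1..l. of_nat j ^ p) - (if p = 0 then 1 else 0)))"
proof -
  \<comment> \<open>For p = 0 the term j = 0 counts as 0^0 = 1; this is the origin of the summand
    with the entry deleted.\<close>
  have 1: "(\<Sum>j\<le>l. of_nat j ^ p) = (\<Sum>j=1..l. of_nat j ^ p) + (if p = 0 then 1 else (0::rat))" for l
    by (simp add: atMost_atLeast0 sum.atLeast_Suc_atMost power_0_left)
  have "li_index (u @ [- int p, b]) $ n = of_nat n powi (- b) *
      (\<Sum>j<n. of_nat j ^ p * (\<Sum>l<j. li_index u $ l))"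
    using li_index_snoc[of "u @ [- int p]" b n] by (simp add: li_index_snoc)
  then show ?thesis
    unfolding sum_lessThan_triangle 1 by (simp add: diff_diff_eq)
qed

lemma li_index_nonpos:
  fixes u :: index and b :: int and p :: nat
  defines "c \<equiv> fps_const (1 / of_nat (Suc p))"
  shows "li_index (u @ [- int p, b]) =
    c * (\<Sum>i=0..p. fps_const (of_nat (Suc p choose i) * bernoulli_minus i) * li_index (u @ [b - int p - 1 + int i]))
    - (if p = 0 then li_index (u @ [b]) else 0)
    - (if u \<noteq> [] then c * (\<Sum>i=0..p. fps_const (of_nat (Suc p choose i) * bernoulli_plus i) *
         li_index (butlast u @ [last u - int p - 1 + int i, b])) else 0)"
    (is "?L = c * ?R1 - ?R2 - ?R3")
proof (rule fps_ext)
  fix n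
  let ?P = "\<lambda>l. \<Sum>j=1..l. of_nat j ^ p :: rat"
  have s: "of_nat (Suc p) \<noteq> (0::rat)" by (rule of_nat_neq_0)
  have R1: "(c * ?R1) $ n = of_nat n powi (- b) * (\<Sum>l<n. li_index u $ l) * (\<Sum>j<n. of_nat j ^ p)"
    unfolding c_def fps_mult_left_const_nth fps_sum_nth li_index_merge_right
    using s by (simp del: of_nat_Suc)
  have R3: "?R3 $ n = of_nat n powi (- b) * (\<Sum>l<n. li_index u $ l * ?P l)"
  proof (cases u rule: rev_cases)
    case Nil
    \<comment> \<open>Without a left neighbour only l = 0 carries a coefficient, and the sum from 1
      to 0 is empty.\<close>
    have "(\<Sum>l<n. (1::rat fps) $ l * ?P l) = 0"
      by (rule sum.neutral) auto
    with Nil show ?thesis by simp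
  next
    case (snoc u' d)
    have e: "li_index (u' @ [x, b]) $ n = of_nat n powi (- b) * (\<Sum>l<n. li_index (u' @ [x]) $ l)" for x
      using li_index_snoc[of "u' @ [x]" b n] by simp
    have "?R3 $ n = 1 / of_nat (Suc p) * (of_nat n powi (- b) *
      (\<Sum>l<n. \<Sum>i=0..p. of_nat (Suc p choose i) * bernoulli_plus i * li_index (u' @ [d - int p - 1 + int i]) $ l))"
      unfolding c_def
      by (subst sum.swap) (simp add: snoc fps_sum_nth e sum_distrib_left mult_ac del: of_nat_Suc binomial_Suc_Suc)
    also have "\<dots> = of_nat n powi (- b) * (\<Sum>l<n. li_index u $ l * ?P l)"
      unfolding li_index_merge_left
      unfolding mult.assoc sum_distrib_left[symmetric]
      using s by (simp add: snoc del: of_nat_Suc)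
    finally show ?thesis .
  qed
  have R2: "?R2 $ n = of_nat n powi (- b) * (\<Sum>l<n. li_index u $ l) * (if p = 0 then 1 else 0)"
    by (simp add: li_index_snoc)
  show "?L $ n = (c * ?R1 - ?R2 - ?R3) $ n"
    unfolding fps_sub_nth R1 R2 R3 li_index_nonpos_nth
    by (simp add: sum_subtractf right_diff_distrib sum_distrib_right sum_distrib_left mult_ac)
qed

text \<open>Trades list positions for concatenations, the shape that \<open>li_index_nonpos\<close>
  and the tail sums can use. The right neighbour \<open>b\<close> exists because a regularizable
  index cannot end in a nonpositive entry.\<close>

lemma reduce_split:
  assumes "regularizable k" and "\<not> positive k"
  obtains u p b v where "k = u @ - int p # b # v"
    and "reduce k = scale (1 / of_nat (Suc p)) (\<Sum>i=0..p.
          scale (of_nat (Suc p choose i) * bernoulli_minus i) (basis (u @ (b - int p - 1 + int i) # v)))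
       - (if p = 0 then basis (u @ b # v) else 0)
       - (if u \<noteq> [] then scale (1 / of_nat (Suc p)) (\<Sum>i=0..p.
          scale (of_nat (Suc p choose i) * bernoulli_plus i)
            (basis (butlast u @ (last u - int p - 1 + int i) # b # v))) else 0)"
proof -
  let ?m = "first_nonpos k"
  have m: "?m + 1 < length k" using first_nonpos_lt[OF assms] .
  have "\<exists>m. m < length k \<and> k ! m \<le> 0"
    using assms(2) by (auto simp: positive_def in_set_conv_nth not_less)
  from LeastI_ex[OF this] have "k ! ?m \<le> 0" unfolding first_nonpos_def by auto
  then obtain p where p: "k ! ?m = - int p" by (metis nonpos_int_cases)
  define u b v where "u = take ?m k" and "b = k ! Suc ?m" and "v = drop (?m + 2) k"
  have k: "k = u @ - int p # b # v"
    using m p unfolding u_def b_def v_def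
    by (metis Cons_nth_drop_Suc Suc_eq_plus1 Suc_lessD add_2_eq_Suc' append_take_drop_id)
  have l: "length u = ?m" using m by (simp add: u_def)
  have u: "?m > 0 \<longleftrightarrow> u \<noteq> []" using l length_greater_0_conv[of u] by simp
  have "merge_right k ?m i = u @ (b - int p - 1 + int i) # v" for i
    using p by (simp add: merge_right_def u_def b_def v_def)
  moreover have "delete_at k ?m = u @ b # v"
    unfolding delete_at_def using k l by (metis Suc_eq_plus1 append_eq_conv_conj drop_Suc_Cons drop0 add.commute drop_drop plus_1_eq_Suc list.sel(3) tl_drop drop_Suc)
  moreover have "merge_left k ?m i = butlast u @ (last u - int p - 1 + int i) # b # v" if "u \<noteq> []" for i
  proof -
    obtain u' d where "u = u' @ [d]" using \<open>u \<noteq> []\<close> by (metis rev_exhaust)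
    with k l have "?m = Suc (length u')" "k = u' @ d # - int p # b # v" by simp_all
    then show ?thesis using \<open>u = u' @ [d]\<close> by (simp add: merge_left_def nth_append)
  qed
  ultimately have "reduce k = scale (1 / of_nat (Suc p)) (\<Sum>i=0..p.
          scale (of_nat (Suc p choose i) * bernoulli_minus i) (basis (u @ (b - int p - 1 + int i) # v)))
       - (if p = 0 then basis (u @ b # v) else 0)
       - (if u \<noteq> [] then scale (1 / of_nat (Suc p)) (\<Sum>i=0..p.
          scale (of_nat (Suc p choose i) * bernoulli_plus i)
            (basis (butlast u @ (last u - int p - 1 + int i) # b # v))) else 0)"
    unfolding reduce_def Let_def p u by (simp add: nat_add_distrib)
  with k show thesis by (rule that)
qed

lemma li_reduce:
  assumes "regularizable k" and "\<not> positive k"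
  shows "lin_eval li_index (reduce k) = li_index k"
proof -
  obtain u p b v where k: "k = u @ - int p # b # v"
    and r: "reduce k = scale (1 / of_nat (Suc p)) (\<Sum>i=0..p.
          scale (of_nat (Suc p choose i) * bernoulli_minus i) (basis (u @ (b - int p - 1 + int i) # v)))
       - (if p = 0 then basis (u @ b # v) else 0)
       - (if u \<noteq> [] then scale (1 / of_nat (Suc p)) (\<Sum>i=0..p.
          scale (of_nat (Suc p choose i) * bernoulli_plus i)
            (basis (butlast u @ (last u - int p - 1 + int i) # b # v))) else 0)"
    using reduce_split[OF assms] .
  let ?F = "foldr letter_op (index_word v)"
  have F0: "?F 0 = 0" using foldr_letter_op_linear(3)[of _ 0 0] by simp
  have Fsum: "?F (sum g S) = (\<Sum>i\<in>S. ?F (g i))" for g :: "nat \<Rightarrow> rat fps" and S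
    by (induction S rule: infinite_finite_induct) (auto simp: F0 foldr_letter_op_linear)
  have e1: "li_index (w @ x # v) = ?F (li_index (w @ [x]))" for w x
    using li_index_append[of "w @ [x]" v] by simp
  have e2: "li_index (w @ x # y # v) = ?F (li_index (w @ [x, y]))" for w x y
    using li_index_append[of "w @ [x, y]" v] by simp
  show ?thesis
    unfolding r unfolding k e2 li_index_nonpos
    by (simp add: lin_eval_diff lin_eval_scale lin_eval_sum e1 e2 e1[of "[]", unfolded append_Nil] foldr_letter_op_linear Fsum F0
        del: of_nat_Suc binomial_Suc_Suc fps_const_mult)
qed

section \<open>Admissibility\<close>

text \<open>The tail sums of \<open>min_tail\<close> as a function of the tail alone, so that they
  split along concatenations.\<close>

definition excess :: "index \<Rightarrow> int" where
  "excess k = (\<Sum>a\<leftarrow>k. a - 1)"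

lemma excess_simps [simp]: "excess [] = 0" "excess (a # k) = a - 1 + excess k"
  "excess (k @ l) = excess k + excess l"
  by (simp_all add: excess_def)

lemma admissible_iff:
  "admissible k \<longleftrightarrow> (\<forall>t<length k. 0 < (\<Sum>i\<in>{t..<length k}. k ! i - 1))"
proof (cases "k = []")
  case False
  then have "{..<length k} \<noteq> {}" by (simp add: lessThan_empty_iff)
  with False show ?thesis unfolding admissible_def min_tail_def by (auto simp: Min_gr_iff)
qed (simp add: admissible_def min_tail_def)

lemma admissible_Nil [simp]: "admissible []"
  by (simp add: admissible_iff)

lemma admissible_Cons [simp]: "admissible (a # k) \<longleftrightarrow> 0 < a - 1 + excess k \<and> admissible k"
proof -
  have "excess l = (\<Sum>i\<in>{0..<length l}. l ! i - 1)" for l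
    by (simp add: excess_def sum_list_sum_nth)
  note zero = this[of "a # k", symmetric]
  have "(\<Sum>i\<in>{Suc t..<Suc (length k)}. (a # k) ! i - 1) = (\<Sum>i\<in>{t..<length k}. k ! i - 1)" for t
    by (simp add: sum.shift_bounds_Suc_ivl del: sum.op_ivl_Suc)
  with zero show ?thesis
    by (simp add: admissible_iff All_less_Suc2 del: sum.op_ivl_Suc)
qed

lemma admissible_imp_regularizable: "admissible k \<Longrightarrow> regularizable k"
  by (simp add: admissible_def regularizable_def)

lemma admissible_appendD: "admissible (u @ v) \<Longrightarrow> admissible v"
  by (induction u) auto

lemma admissible_append_mono:
  "admissible (u @ v) \<Longrightarrow> admissible v' \<Longrightarrow> excess v \<le> excess v' \<Longrightarrow> admissible (u @ v')"
  by (induction u) auto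

lemma span_sum: "(\<And>i. i \<in> I \<Longrightarrow> g i \<in> formal_span S) \<Longrightarrow> sum g I \<in> formal_span S"
  by (induction I rule: infinite_finite_induct) (auto intro: span_add)

text \<open>The entry -p contributes -p - 1 to a tail sum, and merging adds -p - 1 + i to its
  neighbour, so tail sums through both change by i \<ge> 0. Deleting the entry raises them by p +
  1.\<close>

lemma reduce_admissible:
  assumes "admissible k" and "\<not> positive k"
  shows "reduce k \<in> formal_span adm"
proof -
  obtain u p b v where k: "k = u @ - int p # b # v"
    and r: "reduce k = scale (1 / of_nat (Suc p)) (\<Sum>i=0..p.
          scale (of_nat (Suc p choose i) * bernoulli_minus i) (basis (u @ (b - int p - 1 + int i) # v)))
       - (if p = 0 then basis (u @ b # v) else 0)
       - (if u \<noteq> [] then scale (1 / of_nat (Suc p)) (\<Sum>i=0..p.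
          scale (of_nat (Suc p choose i) * bernoulli_plus i)
            (basis (butlast u @ (last u - int p - 1 + int i) # b # v))) else 0)"
    using reduce_split[OF admissible_imp_regularizable[OF assms(1)] assms(2)] .
  have v: "admissible (- int p # b # v)" using assms(1) admissible_appendD unfolding k by blast
  have right: "u @ (b - int p - 1 + int i) # v \<in> adm" for i
    unfolding adm_def using assms(1)[unfolded k] v
    by (auto intro!: admissible_append_mono[of u "- int p # b # v"])
  have del: "u @ b # v \<in> adm"
    unfolding adm_def using assms(1)[unfolded k] v
    by (auto intro!: admissible_append_mono[of u "- int p # b # v"])
  have left: "butlast u @ (last u - int p - 1 + int i) # b # v \<in> adm" if "u \<noteq> []" for i
  proof -
    obtain u' d where u: "u = u' @ [d]" using \<open>u \<noteq> []\<close> by (metis rev_exhaust)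
    have a: "admissible (u' @ d # - int p # b # v)" using assms(1) by (simp add: k u)
    show ?thesis
      unfolding adm_def u using a v admissible_appendD[OF a]
      by (auto intro!: admissible_append_mono[OF a])
  qed
  have if_span: "(if P then x else 0) \<in> formal_span adm" if "P \<Longrightarrow> x \<in> formal_span adm"
    for P and x :: "index formal"
    using that by simp
  show ?thesis
    unfolding r by (intro span_diff span_scale span_sum span_basis if_span right del left)
qed

lemma span_mono: "x \<in> formal_span S \<Longrightarrow> S \<subseteq> T \<Longrightarrow> x \<in> formal_span T"
  by (auto simp: formal_span_def)

lemma pi_index_admissible:
  assumes "admissible k"
  shows "pi_index k \<in> formal_span adm_pos \<and> lin_eval li_index (pi_index k) = li_index k"
  using assms
proof (induction k rule: length_induct)
  case (1 k)
  show ?case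
  proof (cases "positive k")
    case True
    with 1 show ?thesis by (subst (1 2) pi_index.simps) (auto simp: adm_pos_def intro: span_basis)
  next
    case False
    have reg: "regularizable k" using 1 by (simp add: admissible_imp_regularizable)
    have IH: "pi_index l \<in> formal_span adm_pos \<and> lin_eval li_index (pi_index l) = li_index l"
      if "l \<in> Poly_Mapping.keys (reduce k)" for l
      using 1 that length_reduce[OF reg False that] reduce_admissible[OF _ False]
      by (auto simp: formal_span_def adm_def)
    have p: "pi_index k = lin_ext pi_index (reduce k)"
      using False reg by (subst pi_index.simps) simp
    have "lin_eval li_index (pi_index k) = lin_eval li_index (reduce k)"
      unfolding p lin_eval_lin_ext using IH by (intro lin_eval_cong) auto
    then show ?thesis
      using li_reduce[OF reg False] IH by (auto simp: p intro!: span_lin_ext)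
  qed
qed

lemma pi_plus_span:
  assumes "x \<in> formal_span adm"
  shows "pi_plus x \<in> formal_span adm_pos"
proof -
  have "admissible a" if "a \<in> Poly_Mapping.keys x" for a
    using assms that by (auto simp: formal_span_def adm_def)
  then show ?thesis
    unfolding pi_plus_def by (intro span_lin_ext) (simp add: pi_index_admissible)
qed

lemma li_pi_plus:
  assumes "x \<in> formal_span adm"
  shows "lin_eval li_index (pi_plus x) = lin_eval li_index x"
  unfolding pi_plus_def lin_eval_lin_ext
  using assms pi_index_admissible by (intro lin_eval_cong) (auto simp: formal_span_def adm_def)

text \<open>The tail sums defining admissibility are the weights of the prefixes of \<open>index_word k\<close> that
  end in \<open>y\<close>. Since the weights are monotone between two letters \<open>y\<close>, all nonempty prefixes may be
  considered; the offset \<open>h\<close> makes the condition additive under the shuffle product.\<close>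

fun weight :: "letter \<Rightarrow> int" where
  "weight J = 1"
| "weight D = -1"
| "weight Y = -1"

fun adm_word :: "int \<Rightarrow> letter list \<Rightarrow> bool" where
  "adm_word h [] \<longleftrightarrow> True"
| "adm_word h (c # w) \<longleftrightarrow> 0 < h + weight c \<and> adm_word (h + weight c) w"

lemma adm_word_mono: "adm_word h w \<Longrightarrow> h \<le> h' \<Longrightarrow> adm_word h' w"
  by (induction w arbitrary: h h') force+

text \<open>A cancelled pair of \<open>J\<close> and \<open>D\<close> has total weight 0, so
  dropping it leads back to offset \<open>h\<close>.\<close>

lemma adm_word_lcons:
  assumes "0 \<le> h" and "0 < h + weight c" and "adm_word (h + weight c) w"
  shows "adm_word h (lcons c w)"
  using assms by (cases "(c, w)" rule: lcons.cases) auto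

lemma adm_word_lconc:
  assumes "0 \<le> h" and "0 < h + weight c" and "x \<in> formal_span {w. adm_word (h + weight c) w}"
  shows "lconc c x \<in> formal_span {w. adm_word h w}"
  unfolding lconc_def
  using assms by (auto intro!: span_lin_ext span_basis adm_word_lcons simp: formal_span_def[of "{w. adm_word (h + weight c) w}"])

text \<open>A letter moved to the front takes its weight from the factor it leaves, so the offsets
  add. In the subtracted terms of the rules with \<open>D\<close> the two changes cancel: a - 1 and
  b + 1, or a + 1 and b - 1.\<close>

lemma adm_word_shuffle_words:
  assumes "0 \<le> a" "0 \<le> b" "adm_word a u" "adm_word b v"
  shows "shuffle_words u v \<in> formal_span {w. adm_word (a + b) w}"
  using assms
proof (induction u v arbitrary: a b rule: shuffle_words.induct)
  case (1 v)
  then show ?case using adm_word_mono[of b v "a + b"] by (simp add: span_basis)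
next
  case (2 c u)
  then show ?case using adm_word_mono[of a "c # u" "a + b"] by (auto intro!: span_basis simp del: adm_word.simps)
next
  case (3 u c v)
  then show ?case using "3.IH"[of "a - 1" b] by (auto intro!: adm_word_lconc simp: algebra_simps)
next
  case ("4_1" u v)
  then show ?case using "4_1.IH"[of a "b - 1"] by (auto intro!: adm_word_lconc simp: algebra_simps)
next
  case ("4_2" u v)
  then show ?case using "4_2.IH"[of a "b - 1"] by (auto intro!: adm_word_lconc simp: algebra_simps)
next
  case (5 u v)
  then show ?case using "5.IH"(1)[of "a + 1" b] "5.IH"(2)[of a "b + 1"]
    by (auto intro!: span_add adm_word_lconc simp: algebra_simps)
next
  case (6 u v)
  then show ?case using "6.IH"(1)[of "a - 1" b] "6.IH"(2)[of "a - 1" "b + 1"]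
    by (auto intro!: span_diff adm_word_lconc simp: algebra_simps)
next
  case (7 u v)
  then show ?case using "7.IH"(1)[of "a - 1" b] "7.IH"(2)[of "a - 1" "b + 1"]
    by (auto intro!: span_diff adm_word_lconc simp: algebra_simps)
next
  case (8 u v)
  then show ?case using "8.IH"(1)[of a "b - 1"] "8.IH"(2)[of "a + 1" "b - 1"]
    by (auto intro!: span_diff adm_word_lconc simp: algebra_simps)
qed

lemma adm_word_jpow:
  assumes "0 \<le> h"
  shows "adm_word h (jpow a @ Y # w) \<longleftrightarrow> 1 < h + a \<and> adm_word (h + a - 1) w"
proof -
  \<comment> \<open>Rising prefix sums stay positive because they start from
    \<open>h \<ge> 0\<close>, falling ones because their last value is positive.\<close>
  have J: "adm_word h (replicate n J @ Y # w) \<longleftrightarrow> 1 < h + int n \<and> adm_word (h + int n - 1) w" for n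
    using assms
  proof (induction n arbitrary: h)
    case (Suc n)
    have "h + 1 + int n = h + int (Suc n)" by simp
    with Suc.prems Suc.IH[of "h + 1"] show ?case by simp
  qed auto
  have D: "adm_word h (replicate n D @ Y # w) \<longleftrightarrow> 1 < h - int n \<and> adm_word (h - int n - 1) w" for n
  proof (induction n arbitrary: h)
    case (Suc n)
    have "h - 1 - int n = h - int (Suc n)" by simp
    with Suc.IH[of "h - 1"] show ?case by auto
  qed auto
  obtain n where "a = int n \<or> a = - int n" by (metis int_cases2)
  then show ?thesis using J[of n] D[of n] by (elim disjE) (simp_all only: jpow_replicate diff_conv_add_uminus)
qed

text \<open>\<open>index_word\<close> writes the last entry first, so tails of the index become
  prefixes of the word; passing the block of an entry \<open>a\<close> shifts the offset by a -
  1.\<close>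

lemma adm_word_index_word_iff:
  "0 \<le> h \<Longrightarrow> adm_word h (index_word k) \<longleftrightarrow> (\<forall>u v. k = u @ v \<longrightarrow> v \<noteq> [] \<longrightarrow> 0 < h + excess v)"
proof (induction k arbitrary: h rule: rev_induct)
  case Nil
  then show ?case by simp
next
  case (snoc a k)
  have split: "(\<forall>u v. k @ [a] = u @ v \<longrightarrow> v \<noteq> [] \<longrightarrow> 0 < h + excess v) \<longleftrightarrow>
     1 < h + a \<and> (\<forall>u v. k = u @ v \<longrightarrow> v \<noteq> [] \<longrightarrow> 0 < h + a - 1 + excess v)" (is "?l \<longleftrightarrow> ?r")
  proof
    assume l: ?l
    have *: "0 < h + a - 1 + excess v" if "k = u @ v" for u v
      using l[rule_format, of u "v @ [a]"] that by simp
    have "1 < h + a" using *[of k "[]"] by simp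
    with * show ?r by blast
  next
    assume r: ?r
    show ?l
    proof (intro allI impI)
      fix u v assume uv: "k @ [a] = u @ v" "v \<noteq> []"
      obtain v' where v: "v = v' @ [a]" and k: "k = u @ v'"
        using uv by (cases v rule: rev_cases) auto
      have "v' \<noteq> [] \<Longrightarrow> 0 < h + a - 1 + excess v'"
        using r[THEN conjunct2, rule_format, OF k] .
      moreover have "1 < h + a" using r by (rule conjunct1)
      ultimately show "0 < h + excess v" unfolding v by (cases "v' = []") simp_all
    qed
  qed
  have "index_word (k @ [a]) = jpow a @ Y # index_word k" by simp
  then have "adm_word h (index_word (k @ [a])) \<longleftrightarrow> 1 < h + a \<and> adm_word (h + a - 1) (index_word k)"
    by (simp only: adm_word_jpow[OF snoc.prems])
  also have "\<dots> \<longleftrightarrow> ?r" by (rule conj_cong[OF refl snoc.IH]) simp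
  finally show ?case unfolding split .
qed

lemma admissible_suffix_iff: "admissible k \<longleftrightarrow> (\<forall>u v. k = u @ v \<longrightarrow> v \<noteq> [] \<longrightarrow> 0 < excess v)"
proof (induction k)
  case (Cons a k)
  have "(\<forall>u v. a # k = u @ v \<longrightarrow> v \<noteq> [] \<longrightarrow> 0 < excess v) \<longleftrightarrow>
      0 < excess (a # k) \<and> (\<forall>u v. k = u @ v \<longrightarrow> v \<noteq> [] \<longrightarrow> 0 < excess v)" (is "?l \<longleftrightarrow> ?r")
  proof
    assume l: ?l
    have "0 < excess (a # k)" using l[rule_format, of "[]" "a # k"] by simp
    moreover have "0 < excess v" if "k = u @ v" "v \<noteq> []" for u v
      using l[rule_format, of "a # u" v] that by simp
    ultimately show ?r by blast
  next
    assume r: ?r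
    show ?l
    proof (intro allI impI)
      fix u v assume "a # k = u @ v" "v \<noteq> []"
      with r show "0 < excess v" by (cases u) auto
    qed
  qed
  with Cons show ?case by simp
qed simp

lemma adm_word_index_word: "adm_word 0 (index_word k) \<longleftrightarrow> admissible k"
  by (simp add: adm_word_index_word_iff admissible_suffix_iff)

section \<open>Linear independence of polylogarithms\<close>

lemma poly_eqI_large:
  fixes p q :: "rat poly"
  assumes "\<And>n. n \<ge> N \<Longrightarrow> poly p (of_nat n) = poly q (of_nat n)"
  shows "p = q"
proof (rule ccontr)
  assume "p \<noteq> q"
  then have "finite {x. poly (p - q) x = 0}" by (intro poly_roots_finite) simp
  moreover have "of_nat ` {N..} \<subseteq> {x. poly (p - q) x = 0}" using assms by auto
  ultimately have "finite ((of_nat :: nat \<Rightarrow> rat) ` {N..})" by (rule rev_finite_subset)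
  then have "finite {N..}" by (rule finite_imageD) (simp add: inj_on_def)
  then show False by (simp add: infinite_Ici)
qed

definition shift :: "rat poly \<Rightarrow> rat poly" where
  "shift p = pcompose p [:1, 1:]"

lemma poly_shift [simp]: "poly (shift p) x = poly p (x + 1)"
  by (simp add: shift_def poly_pcompose add.commute)

text \<open>For R = P/Q the equation reads R(x+1) - R(x) = G/x^A. The largest integer pole of R is a
  pole of the difference, and so is m - 1 for the smallest one m. Both places must be 0, so the
  largest is 0 and the smallest is 1, which is absurd. Hence R has no integer pole and G/x^A is
  regular at 0.\<close>

lemma shift_difference_root_zero:
  fixes P Q :: "rat poly"
  assumes "Q \<noteq> 0" and "0 < A"
    and eq: "monom 1 A * (shift P * Q - P * shift Q) = G * Q * shift Q"
  shows "poly G 0 = 0"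
proof -
  \<comment> \<open>In lowest terms the roots of the denominator are genuine poles.\<close>
  define g where "g = gcd P Q"
  obtain P' Q' where PQ: "P = g * P'" "Q = g * Q'" and cop: "coprime P' Q'"
    unfolding g_def using gcd_coprime_exists[of P Q] \<open>Q \<noteq> 0\<close> by (metis gcd_eq_0_iff mult.commute)
  have g: "g \<noteq> 0" "Q' \<noteq> 0" using \<open>Q \<noteq> 0\<close> PQ by auto
  have sh: "shift (p * q) = shift p * shift q" for p q
    by (simp add: shift_def pcompose_mult)
  have sg: "shift g \<noteq> 0"
    unfolding shift_def using g(1) by (simp add: pcompose_eq_0_iff)
  have "(g * shift g) * (monom 1 A * (shift P' * Q' - P' * shift Q')) = (g * shift g) * (G * Q' * shift Q')"
    using eq by (simp add: PQ sh algebra_simps)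
  then have eq': "monom 1 A * (shift P' * Q' - P' * shift Q') = G * Q' * shift Q'"
    using g(1) sg by simp
  have ev: "x ^ A * (poly P' (x + 1) * poly Q' x - poly P' x * poly Q' (x + 1))
      = poly G x * poly Q' x * poly Q' (x + 1)" for x
    using arg_cong[OF eq', of "\<lambda>p. poly p x"] by (simp add: poly_monom)
  have no_common: "poly P' x \<noteq> 0" if "poly Q' x = 0" for x
    using cop that coprime_common_divisor[of P' Q' "[:-x, 1:]"]
    by (auto simp: poly_eq_0_iff_dvd is_unit_pCons_iff)
  define R where "R = {i :: int. poly Q' (of_int i) = 0}"
  have "finite R"
  proof -
    have "finite {x. poly Q' x = 0}" using g(2) by (rule poly_roots_finite)
    moreover have "of_int ` R \<subseteq> {x. poly Q' x = 0}" by (auto simp: R_def)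
    ultimately have "finite ((of_int :: int \<Rightarrow> rat) ` R)" by (rule rev_finite_subset)
    then show ?thesis by (rule finite_imageD) (simp add: inj_on_def)
  qed
  have "R = {}"
  proof (rule ccontr)
    assume ne: "R \<noteq> {}"
    have M: "Max R \<in> R" and m: "Min R \<in> R" using \<open>finite R\<close> ne by auto
    have "Max R + 1 \<notin> R" "Min R - 1 \<notin> R"
      using \<open>finite R\<close> Max_ge[of R "Max R + 1"] Min_le[of R "Min R - 1"] by auto
    then have n: "poly Q' (of_int (Max R) + 1) \<noteq> 0" "poly Q' (of_int (Min R) - 1) \<noteq> 0"
      by (simp_all add: R_def)
    have z: "poly Q' (of_int (Max R)) = 0" "poly Q' (of_int (Min R)) = 0"
      using M m by (simp_all add: R_def)
    have "Max R = 0"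
      using ev[of "of_int (Max R)"] n(1) z(1) no_common[OF z(1)] by simp
    moreover have "Min R = 1"
      using ev[of "of_int (Min R) - 1"] n(2) z(2) no_common[OF z(2)] by simp
    moreover have "Min R \<le> Max R" using \<open>finite R\<close> M by simp
    ultimately show False by simp
  qed
  then have "poly Q' (of_int 0) \<noteq> 0" "poly Q' (of_int 1) \<noteq> 0" unfolding R_def by blast+
  with ev[of 0] \<open>0 < A\<close> show ?thesis by (simp add: zero_power)
qed

text \<open>The multiple harmonic sum over 0 < n_1 < ... < n_r < n. Unlike the coefficients of
  \<open>li_index\<close>, these sums obey a first-order difference equation whose inhomogeneous
  part is the sum for the index without its last entry.\<close>

definition hsum :: "index \<Rightarrow> nat \<Rightarrow> rat" where
  "hsum k n = (\<Sum>i<n. li_index k $ i)"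

lemma hsum_Nil: "0 < n \<Longrightarrow> hsum [] n = 1"
  by (simp add: hsum_def sum.delta if_distrib)

lemma hsum_snoc: "hsum (k @ [a]) (Suc n) = hsum (k @ [a]) n + of_nat n powi (- a) * hsum k n"
  by (simp add: hsum_def li_index_snoc)

text \<open>R/P is invariant under x -> x + 1, hence constant along the integers beyond the last
  natural zero of P.\<close>

lemma shift_proportional:
  assumes "P \<noteq> 0" and "P * shift R = shift P * R"
  obtains c where "R = smult c P"
proof -
  have "finite {x. poly P x = 0}" using assms(1) by (rule poly_roots_finite)
  then have "finite ((of_nat :: nat \<Rightarrow> rat) -` {x. poly P x = 0})"
    by (rule finite_vimageI) (simp add: inj_on_def)
  then obtain N where N: "\<And>n. poly P (of_nat n) = 0 \<Longrightarrow> n < N"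
    using finite_nat_set_iff_bounded by auto
  define c where "c = poly R (of_nat N) / poly P (of_nat N)"
  have "poly R (of_nat n) = c * poly P (of_nat n)" if "N \<le> n" for n
    using that
  proof (induction n rule: dec_induct)
    case base
    show ?case using N[of N] by (auto simp: c_def)
  next
    case (step n)
    have nz: "poly P (of_nat n) \<noteq> 0" using N[of n] step.hyps by auto
    have "poly P (of_nat n) * poly R (of_nat (Suc n)) = poly P (of_nat (Suc n)) * poly R (of_nat n)"
      using arg_cong[OF assms(2), of "\<lambda>p. poly p (of_nat n)"] by (simp add: add.commute)
    then have "poly P (of_nat n) * poly R (of_nat (Suc n)) = poly P (of_nat n) * (c * poly P (of_nat (Suc n)))"
      by (simp only: step.IH) (simp add: mult_ac)
    with nz show ?case by simp
  qed
  then have "R = smult c P" by (intro poly_eqI_large[of N]) simp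
  then show thesis by (rule that)
qed

lemma shift_smult: "shift (smult c p) = smult c (shift p)"
  by (simp add: shift_def pcompose_smult)

text \<open>Otherwise a rational function \<open>R\<close> would solve \<open>R(x + 1) - R(x) = -(\<Sum>a\<in>T. r a / x\<^sup>a)\<close>.\<close>

lemma no_rational_antidifference:
  fixes P Q :: "rat poly" and r :: "int \<Rightarrow> rat"
  assumes "Q \<noteq> 0" and "finite T" and T: "\<And>a. a \<in> T \<Longrightarrow> 0 < a \<and> nat a \<le> M"
    and eq: "monom 1 M * (Q * shift P - shift Q * P)
      + Q * (\<Sum>a\<in>T. shift (smult (r a) Q) * monom 1 (M - nat a)) = 0"
    and "a \<in> T"
  shows "r a = 0"
proof (rule ccontr)
  assume "r a \<noteq> 0"
  define T' where "T' = {a \<in> T. r a \<noteq> 0}"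
  have T': "finite T'" "a \<in> T'" using assms(2,5) \<open>r a \<noteq> 0\<close> by (auto simp: T'_def)
  \<comment> \<open>With the largest exponent that actually occurs, \<open>poly G 0\<close> is minus
    its coefficient, and \<open>shift_difference_root_zero\<close> makes it vanish.\<close>
  define A where "A = nat (Max T')"
  have max: "Max T' \<in> T'" using T' by (intro Max_in) auto
  then have A: "0 < A" "A \<le> M" using T[of "Max T'"] by (auto simp: A_def T'_def)
  define G where "G = - (\<Sum>a\<in>T'. smult (r a) (monom 1 (A - nat a)))"
  have "(\<Sum>a\<in>T. shift (smult (r a) Q) * monom 1 (M - nat a))
      = (\<Sum>a\<in>T'. shift (smult (r a) Q) * monom 1 (M - nat a))"
    using \<open>finite T\<close> by (intro sum.mono_neutral_right) (auto simp: T'_def shift_def)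
  also have "\<dots> = (\<Sum>a\<in>T'. monom 1 (M - A) * shift Q * smult (r a) (monom 1 (A - nat a)))"
  proof (rule sum.cong)
    fix a assume "a \<in> T'"
    then have "nat a \<le> A" unfolding A_def using T'(1) by (intro nat_mono Max_ge)
    then have "M - nat a = (M - A) + (A - nat a)" using A by simp
    then have "monom (1::rat) (M - nat a) = monom 1 (M - A) * monom 1 (A - nat a)"
      by (simp add: mult_monom)
    then show "shift (smult (r a) Q) * monom 1 (M - nat a)
        = monom 1 (M - A) * shift Q * smult (r a) (monom 1 (A - nat a))"
      by (simp add: shift_smult mult_ac)
  qed simp
  also have "\<dots> = - (monom 1 (M - A) * shift Q * G)"
    by (simp add: G_def sum_distrib_left)
  finally have sum: "(\<Sum>a\<in>T. shift (smult (r a) Q) * monom 1 (M - nat a)) = - (monom 1 (M - A) * shift Q * G)" .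
  have m: "monom 1 M = monom 1 (M - A) * monom (1::rat) A" using A by (simp add: mult_monom)
  have "monom 1 (M - A) * (monom 1 A * (shift P * Q - P * shift Q)) = monom 1 (M - A) * (G * Q * shift Q)"
    using eq unfolding sum m by (simp add: algebra_simps)
  then have "monom 1 A * (shift P * Q - P * shift Q) = G * Q * shift Q"
    by (simp add: monom_eq_0_iff)
  then have "poly G 0 = 0" using \<open>Q \<noteq> 0\<close> A by (intro shift_difference_root_zero)
  moreover have "poly G 0 = - (\<Sum>a\<in>T'. if a = Max T' then r a else 0)"
    unfolding G_def poly_minus poly_sum
  proof (intro arg_cong[of _ _ uminus] sum.cong refl)
    fix a assume a: "a \<in> T'"
    then have "a \<le> Max T'" "0 < a" using T' T by (auto simp: T'_def)
    then have "A - nat a = 0 \<longleftrightarrow> a = Max T'" by (auto simp: A_def)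
    then show "poly (smult (r a) (monom 1 (A - nat a))) 0 = (if a = Max T' then r a else 0)"
      by (auto simp: poly_monom power_0_left)
  qed
  ultimately have "r (Max T') = 0" using T'(1) max by (simp add: sum.delta)
  with max show False by (simp add: T'_def)
qed

lemma sum_split_snoc:
  fixes f :: "index \<Rightarrow> rat"
  assumes "finite S" and "\<And>l a. l @ [a] \<in> S \<Longrightarrow> l \<in> S'" and "finite S'"
  shows "(\<Sum>l\<in>S - {[]}. f l) = (\<Sum>l\<in>S'. \<Sum>a\<in>{a. l @ [a] \<in> S}. f (l @ [a]))"
proof -
  have fin: "finite {a. l @ [a] \<in> S}" for l
  proof -
    have "finite ((\<lambda>a. l @ [a]) -` S)" using assms(1) by (rule finite_vimageI) (simp add: inj_on_def)
    then show ?thesis by (simp add: vimage_def)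
  qed
  have "(\<Sum>l\<in>S'. \<Sum>a\<in>{a. l @ [a] \<in> S}. f (l @ [a])) = (\<Sum>(l, a)\<in>(SIGMA l:S'. {a. l @ [a] \<in> S}). f (l @ [a]))"
    using assms(3) fin by (intro sum.Sigma) auto
  also have "\<dots> = (\<Sum>l\<in>S - {[]}. f l)"
  proof (rule sum.reindex_bij_witness[where i = "\<lambda>l. (butlast l, last l)" and j = "\<lambda>(l, a). l @ [a]"])
    fix l assume "l \<in> S - {[]}"
    then show "(butlast l, last l) \<in> (SIGMA l:S'. {a. l @ [a] \<in> S})"
      using assms(2)[of "butlast l" "last l"] by auto
  qed auto
  finally show ?thesis by simp
qed

text \<open>For \<open>k\<close> of maximal length, \<open>P k\<close> times the relation at \<open>n + 1\<close> minus \<open>shift (P k)\<close> times the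
  relation at \<open>n\<close> is a relation without \<open>k\<close>; multiplying by \<open>n\<^sup>M\<close> makes its coefficients
  polynomials. By induction they vanish, and the one at \<open>butlast k\<close> is an equation excluded by
  \<open>no_rational_antidifference\<close>.\<close>

lemma hsum_independent:
  assumes "finite S" and "\<And>l a. l @ [a] \<in> S \<Longrightarrow> l \<in> S" and "\<And>l. l \<in> S \<Longrightarrow> positive l"
    and "\<And>n. N \<le> n \<Longrightarrow> (\<Sum>l\<in>S. poly (P l) (of_nat n) * hsum l n) = 0" and "0 < N"
  shows "\<forall>l\<in>S. P l = 0"
  using assms
proof (induction "card S" arbitrary: S P rule: less_induct)
  case (less S P)
  show ?case
  proof (cases "S = {}")
    case False
    have "Max (length ` S) \<in> length ` S" using less.prems(1) False by (intro Max_in) auto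
    then obtain k where k: "k \<in> S" "length k = Max (length ` S)" by auto
    have k: "k \<in> S" "\<And>l. l \<in> S \<Longrightarrow> length l \<le> length k"
      using k less.prems(1) by simp_all
    let ?S = "S - {k}"
    have card: "card ?S < card S" using k less.prems(1) by (intro psubset_card_mono) auto
    \<comment> \<open>Maximal length of \<open>k\<close> rules out \<open>l = k\<close>, so removing
      \<open>k\<close> keeps the set closed under dropping last entries.\<close>
    have closed: "l \<in> ?S" if "l @ [a] \<in> S" for l a
      using less.prems(2)[OF that] k(2)[OF that] by auto
    have rest: "\<forall>l\<in>S. P l = 0" if "P k = 0"
    proof -
      have "\<forall>l\<in>?S. P l = 0"
      proof (rule less.hyps[OF card])
        show "(\<Sum>l\<in>?S. poly (P l) (of_nat n) * hsum l n) = 0" if "N \<le> n" for n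
          using less.prems(4)[OF that] \<open>P k = 0\<close> less.prems(1) k(1) by (simp add: sum.remove)
      qed (use less.prems closed in \<open>(blast | simp)+\<close>)
      with that show ?thesis by blast
    qed
    have "P k = 0"
    proof (rule ccontr)
      assume Pk: "P k \<noteq> 0"
      \<comment> \<open>A common bound for the entries, so that n^M clears every denominator
        n^a.\<close>
      obtain M :: nat where M: "\<And>l a. l \<in> S \<Longrightarrow> a \<in> set l \<Longrightarrow> nat a \<le> M"
      proof
        show "nat a \<le> Max (nat ` (\<Union>l\<in>S. set l))" if "l \<in> S" "a \<in> set l" for l a
          using that less.prems(1) by (intro Max_ge) auto
      qed
      define C where "C l = {a. l @ [a] \<in> S}" for l
      have C: "0 < a \<and> nat a \<le> M" if "a \<in> C l" for a l
        using that M[of "l @ [a]" a] less.prems(3)[of "l @ [a]"] by (auto simp: C_def positive_def)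
      have finC: "finite (C l)" for l
      proof -
        have "finite ((\<lambda>a. l @ [a]) -` S)" using less.prems(1) by (rule finite_vimageI) (simp add: inj_on_def)
        then show ?thesis by (simp add: vimage_def C_def)
      qed
      \<comment> \<open>The coefficient of \<open>hsum l n\<close> in the new relation; its second
        part collects what the indices \<open>l @ [a]\<close> contribute through their difference
        equations.\<close>
      define Q where "Q l = monom 1 M * (P k * shift (P l) - shift (P k) * P l)
        + P k * (\<Sum>a\<in>C l. shift (P (l @ [a])) * monom 1 (M - nat a))" for l
      have Q0: "\<forall>l\<in>?S. Q l = 0"
      proof (rule less.hyps[OF card])
        fix n assume n: "N \<le> n"
        with less.prems(5) have "n \<noteq> 0" by simp
        let ?n = "of_nat n :: rat"
        let ?p = "\<lambda>l. poly (P l) ?n" and ?p1 = "\<lambda>l. poly (P l) (?n + 1)"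
        define d where "d l = hsum l (Suc n) - hsum l n" for l
        \<comment> \<open>\<open>hsum []\<close> jumps from 0 to 1 between the arguments 0 and 1,
          hence the hypothesis \<open>0 < N\<close>.\<close>
        have d_Nil: "d [] = 0" using \<open>n \<noteq> 0\<close> by (simp add: d_def hsum_Nil)
        have d_snoc: "?n ^ M * d (l @ [a]) = ?n ^ (M - nat a) * hsum l n" if "a \<in> C l" for l a
        proof -
          have "?n powi (- a) = 1 / ?n ^ nat a" using C[OF that] by (simp add: power_int_def field_simps)
          moreover have "?n ^ M = ?n ^ (M - nat a) * ?n ^ nat a"
            using C[OF that] by (simp flip: power_add)
          ultimately show ?thesis using \<open>n \<noteq> 0\<close> by (simp add: d_def hsum_snoc)
        qed
        have rel: "(\<Sum>l\<in>S. ?p l * hsum l n) = 0" using less.prems(4)[OF n] .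
        have "(\<Sum>l\<in>S. ?p1 l * hsum l (Suc n)) = 0"
          using less.prems(4)[of "Suc n"] n by (simp add: add.commute)
        then have rel1: "(\<Sum>l\<in>S. ?p1 l * hsum l n) + (\<Sum>l\<in>S. ?p1 l * d l) = 0"
          by (simp add: d_def algebra_simps sum_subtractf)
        have "?n ^ M * (\<Sum>l\<in>S. ?p1 l * d l) = (\<Sum>l\<in>S - {[]}. ?p1 l * (?n ^ M * d l))"
          unfolding sum_distrib_left using less.prems(1) d_Nil
          by (intro sum.mono_neutral_cong_right) auto
        also have "\<dots> = (\<Sum>l\<in>?S. \<Sum>a\<in>C l. ?p1 (l @ [a]) * (?n ^ M * d (l @ [a])))"
          unfolding C_def using less.prems(1) closed by (intro sum_split_snoc) auto
        also have "\<dots> = (\<Sum>l\<in>?S. (\<Sum>a\<in>C l. ?p1 (l @ [a]) * ?n ^ (M - nat a)) * hsum l n)"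
          by (simp add: d_snoc sum_distrib_right mult.assoc)
        finally have D: "?n ^ M * (\<Sum>l\<in>S. ?p1 l * d l)
            = (\<Sum>l\<in>?S. (\<Sum>a\<in>C l. ?p1 (l @ [a]) * ?n ^ (M - nat a)) * hsum l n)" .
        \<comment> \<open>The summand of \<open>k\<close> cancels in this combination, so the sums
          on the right may run over all of \<open>S\<close>.\<close>
        have E: "(\<Sum>l\<in>?S. (?p k * ?p1 l - ?p1 k * ?p l) * hsum l n)
            = ?p k * (\<Sum>l\<in>S. ?p1 l * hsum l n) - ?p1 k * (\<Sum>l\<in>S. ?p l * hsum l n)"
          unfolding sum.remove[OF less.prems(1) k(1)]
          by (simp add: algebra_simps sum_subtractf sum_distrib_left)
        have "(\<Sum>l\<in>?S. poly (Q l) ?n * hsum l n)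
            = ?n ^ M * (\<Sum>l\<in>?S. (?p k * ?p1 l - ?p1 k * ?p l) * hsum l n)
              + ?p k * (\<Sum>l\<in>?S. (\<Sum>a\<in>C l. ?p1 (l @ [a]) * ?n ^ (M - nat a)) * hsum l n)"
          by (simp add: Q_def poly_monom poly_sum distrib_right sum.distrib sum_distrib_left[of _ _ ?S] mult.assoc)
        also have "\<dots> = ?n ^ M * ?p k * ((\<Sum>l\<in>S. ?p1 l * hsum l n) + (\<Sum>l\<in>S. ?p1 l * d l))"
          unfolding E rel D[symmetric] by (simp add: algebra_simps)
        finally show "(\<Sum>l\<in>?S. poly (Q l) ?n * hsum l n) = 0"
          by (simp add: rel1)
      qed (use less.prems closed in \<open>(blast | simp)+\<close>)
      show False
      proof (cases k rule: rev_cases)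
        case Nil
        then have "S = {[]}" using k by auto
        then have "P k = 0"
          using less.prems(4,5) Nil by (intro poly_eqI_large[of N]) (simp add: hsum_Nil)
        with Pk show False by simp
      next
        case (snoc k' a0)
        have k': "k' \<in> ?S" "a0 \<in> C k'" using k(1) closed unfolding snoc C_def by auto
        have "\<exists>c. P (k' @ [a]) = smult c (P k)" if "a \<in> C k'" for a
        proof (cases "a = a0")
          case True
          then show ?thesis by (intro exI[of _ 1]) (simp add: snoc)
        next
          case False
          \<comment> \<open>Siblings of \<open>k\<close> have maximal length too, so nothing in
            \<open>S\<close> extends them and the second part of \<open>Q\<close> is empty.\<close>
          have "C (k' @ [a]) = {}" using k(2) by (force simp: C_def snoc)
          moreover have "Q (k' @ [a]) = 0" using Q0 that False by (simp add: C_def snoc)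
          ultimately have "P k * shift (P (k' @ [a])) = shift (P k) * P (k' @ [a])"
            by (simp add: Q_def monom_eq_0_iff)
          from shift_proportional[OF Pk this] show ?thesis by blast
        qed
        then obtain r where r: "\<And>a. a \<in> C k' \<Longrightarrow> P (k' @ [a]) = smult (r a) (P k)" by metis
        \<comment> \<open>P k' / P k would now be a rational antidifference, for a combination whose
          coefficient at \<open>a0\<close> is 1.\<close>
        have "Q k' = 0" using Q0 k'(1) by blast
        then have "monom 1 M * (P k * shift (P k') - shift (P k) * P k')
          + P k * (\<Sum>a\<in>C k'. shift (smult (r a) (P k)) * monom 1 (M - nat a)) = 0"
          using r by (simp add: Q_def)
        from no_rational_antidifference[OF Pk finC _ this k'(2)] C have "r a0 = 0" by blast
        with r[OF k'(2)] snoc Pk show False by simp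
      qed
    qed
    with rest show ?thesis by blast
  qed simp
qed

lemma li_index_independent:
  assumes "x \<in> formal_span {k. positive k}" and "lin_eval li_index x = 0"
  shows "x = 0"
proof -
  \<comment> \<open>Closing the support under prefixes meets the hypothesis of
    \<open>hsum_independent\<close>; the added indices carry coefficient 0.\<close>
  define S where "S = (\<Union>k\<in>Poly_Mapping.keys x. (\<lambda>i. take i k) ` {..length k})"
  have sub: "Poly_Mapping.keys x \<subseteq> S"
    unfolding S_def by force
  have fin: "finite S" by (simp add: S_def)
  have "\<forall>k\<in>S. [:Poly_Mapping.lookup x k:] = 0"
  proof (rule hsum_independent[where N = 1])
    show "l \<in> S" if "l @ [a] \<in> S" for l a
    proof -
      obtain k i where k: "k \<in> Poly_Mapping.keys x" "l @ [a] = take i k"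
        using \<open>l @ [a] \<in> S\<close> by (auto simp: S_def)
      then have "l = take (length l) k" by (metis append_eq_conv_conj append_take_drop_id append.assoc)
      moreover have "length l \<le> length k" using k(2) by (metis calculation length_take min.cobounded1)
      ultimately show ?thesis using k(1) unfolding S_def by blast
    qed
    show "positive l" if "l \<in> S" for l
      using that assms(1) by (fastforce simp: S_def formal_span_def positive_def dest: in_set_takeD)
    fix n
    have "(\<Sum>l\<in>S. Poly_Mapping.lookup x l * hsum l n) = (\<Sum>i<n. lin_eval li_index x $ i)"
      unfolding lin_eval_superset[OF fin sub] fps_sum_nth hsum_def
      by (subst sum.swap) (simp add: sum_distrib_left)
    then show "(\<Sum>l\<in>S. poly [:Poly_Mapping.lookup x l:] (of_nat n) * hsum l n) = 0"
      by (simp add: assms(2))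
  qed (use fin in auto)
  then have "Poly_Mapping.keys x = {}" using sub by (fastforce simp: in_keys_iff simp del: keys_eq_empty)
  then show ?thesis by simp
qed

section \<open>The shuffle product of indices\<close>

text \<open>The flag tells whether the word is read directly after a letter \<open>j\<close>.\<close>

fun pos_word :: "bool \<Rightarrow> letter list \<Rightarrow> bool" where
  "pos_word b [] \<longleftrightarrow> True"
| "pos_word b (J # w) \<longleftrightarrow> pos_word True w"
| "pos_word b (Y # w) \<longleftrightarrow> b \<and> pos_word False w"
| "pos_word b (D # w) \<longleftrightarrow> False"

lemma pos_word_mono: "pos_word False w \<Longrightarrow> pos_word b w"
  by (cases "(False, w)" rule: pos_word.cases) auto

lemma pos_word_lconc_J:
  assumes "x \<in> formal_span {w. pos_word True w}"
  shows "lconc J x \<in> formal_span {w. pos_word b w}"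
  unfolding lconc_def
proof (rule span_lin_ext)
  fix w assume "w \<in> Poly_Mapping.keys x"
  with assms have "pos_word True w" by (auto simp: formal_span_def)
  then show "basis (lcons J w) \<in> formal_span {w. pos_word b w}"
    by (cases "(J, w)" rule: lcons.cases) (auto intro: span_basis)
qed

lemma pos_word_lconc_Y:
  assumes "x \<in> formal_span {w. pos_word False w}"
  shows "lconc Y x \<in> formal_span {w. pos_word True w}"
  unfolding lconc_def using assms
  by (auto intro!: span_lin_ext span_basis simp: formal_span_def[of "{w. pos_word False w}"])

text \<open>The flag marks the factor that supplied the preceding \<open>J\<close>, so at most one
  factor carries it. A leading \<open>Y\<close> needs the flag; hence it follows a \<open>J\<close>
  of its own factor, and the two factors never both begin with \<open>Y\<close>.\<close>

lemma pos_word_shuffle_words: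
  assumes "pos_word a u" "pos_word b v" "\<not> (a \<and> b)"
  shows "shuffle_words u v \<in> formal_span {w. pos_word (a \<or> b) w}"
  using assms
proof (induction u v arbitrary: a b rule: shuffle_words.induct)
  case (1 v)
  then show ?case using pos_word_mono[of v a] by (cases b) (auto intro!: span_basis)
next
  case (2 c u)
  then show ?case using pos_word_mono[of "c # u" b] by (cases a) (auto intro!: span_basis)
next
  case (3 u c v)
  then show ?case using "3.IH"[of False False] by (auto intro!: pos_word_lconc_Y)
next
  case ("4_1" u v)
  then show ?case using "4_1.IH"[of False False] by (auto intro!: pos_word_lconc_Y)
next
  case ("4_2" u v)
  then show ?case using "4_2.IH"[of False False] by (auto intro!: pos_word_lconc_Y)
next
  case (5 u v)
  then show ?case using "5.IH"(1)[of True False] "5.IH"(2)[of False True]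
    by (auto intro!: span_add pos_word_lconc_J)
qed auto

lemma pos_word_index_word: "pos_word False (index_word k) \<longleftrightarrow> positive k"
proof (induction k rule: rev_induct)
  case (snoc a k)
  have "pos_word b (replicate n J @ Y # w) \<longleftrightarrow> (b \<or> 0 < n) \<and> pos_word False w" for b n w
    by (induction n arbitrary: b) auto
  moreover have "\<not> pos_word b (replicate n D @ Y # w)" if "0 < n" for b n w
    using that by (cases n) auto
  ultimately have "pos_word False (jpow a @ Y # w) \<longleftrightarrow> 0 < a \<and> pos_word False w" for w
    by (cases "0 \<le> a") (auto simp: jpow_def)
  with snoc show ?case by (auto simp: positive_def)
qed (simp add: positive_def)

section \<open>Transfer from words to indices\<close>

lemma word_map_index_shuffle: "word_map (x \<squnion>\<squnion> y) = shuffle (word_map x) (word_map y)"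
proof -
  have "shuffle (word_map x) (word_map y) \<in> formal_span y_words"
    by (simp add: shuffle_y_words word_map_y_words)
  then show ?thesis
    by (simp add: index_shuffle_def mod_T_id f_inv_into_f word_map_surj)
qed

lemma lin_eval_word_map: "lin_eval li_word (word_map x) = lin_eval li_index x"
  by (simp add: word_map_def lin_eval_lin_ext li_index_def[abs_def])

lemma li_index_shuffle: "lin_eval li_index (x \<squnion>\<squnion> y) = lin_eval li_index x * lin_eval li_index y"
  by (simp add: word_map_index_shuffle li_shuffle word_map_y_words flip: lin_eval_word_map)

text \<open>Coefficients of a product can be read on words because \<open>index_word\<close> is
  injective, so closure of a class of words carries over to indices. Serves admissibility and
  positivity alike.\<close>

lemma index_shuffle_span:
  assumes P: "\<And>u v. P u \<Longrightarrow> P v \<Longrightarrow> shuffle_words u v \<in> formal_span {w. P w}"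
    and "x \<in> formal_span {k. P (index_word k)}" "y \<in> formal_span {k. P (index_word k)}"
  shows "x \<squnion>\<squnion> y \<in> formal_span {k. P (index_word k)}"
proof -
  have "word_map z \<in> formal_span {w. P w}" if "z \<in> formal_span {k. P (index_word k)}" for z
    unfolding word_map_def using that by (intro span_lin_ext span_basis) (auto simp: formal_span_def)
  then have "word_map (x \<squnion>\<squnion> y) \<in> formal_span {w. P w}"
    unfolding word_map_index_shuffle shuffle_def using assms
    by (intro span_lin_ext P) (auto simp: formal_span_def)
  then have "P (index_word k)" if "k \<in> Poly_Mapping.keys (x \<squnion>\<squnion> y)" for k
    using that by (auto simp: formal_span_def in_keys_iff lookup_word_map[symmetric])
  then show ?thesis by (auto simp: formal_span_def)
qed

lemma index_shuffle_adm:
  "x \<in> formal_span adm \<Longrightarrow> y \<in> formal_span adm \<Longrightarrow> x \<squnion>\<squnion> y \<in> formal_span adm"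
  using index_shuffle_span[of "adm_word 0" x y] adm_word_shuffle_words[of 0 0]
  by (simp add: adm_word_index_word adm_def)

lemma index_shuffle_positive:
  "x \<in> formal_span {k. positive k} \<Longrightarrow> y \<in> formal_span {k. positive k} \<Longrightarrow>
    x \<squnion>\<squnion> y \<in> formal_span {k. positive k}"
  using index_shuffle_span[of "pos_word False" x y] pos_word_shuffle_words[of False _ False]
  by (simp add: pos_word_index_word)

text \<open>On words, two preimages of one class differ by an element of \<open>L_ideal\<close>, so
  the choice made in \<open>index_shuffle\<close> does not affect the series.\<close>

lemma li_phi_eq:
  assumes "phi x = phi y"
  shows "lin_eval li_index x = lin_eval li_index y"
proof -
  have "word_map x \<in> B_class (word_map y)"
    using assms B_class_self[of "word_map x"] by (simp add: phi_def)
  then have "word_map x - word_map y \<in> L_ideal"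
    by (rule B_class_y_words) (simp_all add: word_map_y_words)
  from li_L_ideal[OF this] show ?thesis
    by (simp add: lin_eval_diff lin_eval_word_map)
qed

theorem theorem4p13:
  fixes \<Sigma> \<Sigma>' :: "index formal"
  assumes "\<Sigma> \<in> formal_span adm" and "\<Sigma>' \<in> formal_span adm"
  shows "pi_plus \<Sigma> \<in> formal_span adm_pos
    \<and> \<Sigma> \<squnion>\<squnion> \<Sigma>' \<in> formal_span adm
    \<and> pi_plus (\<Sigma> \<squnion>\<squnion> \<Sigma>') = pi_plus \<Sigma> \<squnion>\<squnion> pi_plus \<Sigma>'
    \<and> (\<forall>\<Theta> \<in> formal_span adm. phi \<Theta> = B_mult (phi \<Sigma>) (phi \<Sigma>')
         \<longrightarrow> pi_plus \<Theta> = pi_plus \<Sigma> \<squnion>\<squnion> pi_plus \<Sigma>')"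
proof -
  have pos: "pi_plus x \<in> formal_span {k. positive k}" if "x \<in> formal_span adm" for x
    using pi_plus_span[OF that] by (rule span_mono) (auto simp: adm_pos_def)
  have adm: "\<Sigma> \<squnion>\<squnion> \<Sigma>' \<in> formal_span adm" using assms by (rule index_shuffle_adm)
  \<comment> \<open>Only the series of \<Theta> enters, so the chosen product and any other
    admissible preimage are treated alike.\<close>
  have main: "pi_plus \<Theta> = pi_plus \<Sigma> \<squnion>\<squnion> pi_plus \<Sigma>'"
    if "\<Theta> \<in> formal_span adm" "lin_eval li_index \<Theta> = lin_eval li_index (\<Sigma> \<squnion>\<squnion> \<Sigma>')" for \<Theta>
  proof -
    have "pi_plus \<Theta> - pi_plus \<Sigma> \<squnion>\<squnion> pi_plus \<Sigma>' = 0"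
    proof (rule li_index_independent)
      show "pi_plus \<Theta> - pi_plus \<Sigma> \<squnion>\<squnion> pi_plus \<Sigma>' \<in> formal_span {k. positive k}"
        using assms that(1) by (intro span_diff index_shuffle_positive pos)
      show "lin_eval li_index (pi_plus \<Theta> - pi_plus \<Sigma> \<squnion>\<squnion> pi_plus \<Sigma>') = 0"
        using assms that by (simp add: lin_eval_diff li_index_shuffle li_pi_plus)
    qed
    then show ?thesis by simp
  qed
  have "lin_eval li_index \<Theta> = lin_eval li_index (\<Sigma> \<squnion>\<squnion> \<Sigma>')" if "phi \<Theta> = B_mult (phi \<Sigma>) (phi \<Sigma>')" for \<Theta>
    using that by (intro li_phi_eq) (simp add: phi_index_shuffle)
  with pi_plus_span[OF assms(1)] adm main show ?thesis by blast
qed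

end
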